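(* Assume that $B(x)=\delta_0(x)$, that is, $W(t,x)=w(t,x)$, $x\in\mathbb{Z}^d$, are i.i.d. Wiener processes, and let $\mathcal{H}_2=2\varkappa\mathcal{A}+\delta_0(x)$. Then $\lambda_0(\mathcal{H}_2)>0$ for any $\varkappa>0$ if and only if $\int_{T^d}\frac{dk}{1-\hat a(k)}=\infty$, i.e. if and only if the random walk $x(t)$ with generator $2\varkappa\mathcal{A}$ is recurrent.
   Context: The kernel $a:\mathbb{Z}^d\to[0,\infty)$ satisfies $a(z)=a(-z)$, $a(0)=0$, $a(z)>0$ if $|z|=1$, $\sum_za(z)=1$; $\mathcal{A}f(x)=\sum_{z\ne0}a(z)(f(x+z)-f(x))$ is a bounded self-adjoint operator on $l^2(\mathbb{Z}^d)$. $\hat a(k)=\sum_za(z)\cos(k\cdot z)$, $k\in T^d=[-\pi,\pi]^d$. $\lambda_0(\mathcal{H}_2)$ is the maximum point of the spectrum of $\mathcal{H}_2$ on $l^2(\mathbb{Z}^d)$; $\delta_0(x)$ acts as multiplication by the indicator of $\{0\}$. The walk is recurrent if its Green function $G_0(0,0)=\int_0^\infty p(t,0,0)dt$ is infinite, where $p(t,x,y)$ is its transition probability. *)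

theory Defs
  imports "HOL-Analysis.Analysis"
begin

text \<open>The lattice \<open>Z\<^sup>d\<close> is \<open>int ^ 'd\<close>, with \<open>d = CARD('d) \<ge> 1\<close>. The embedding into \<open>real ^ 'd\<close> supplies
  the Euclidean length \<open>|z|\<close> and the pairing \<open>k \<cdot> z\<close>.\<close>

definition lattice_vec :: "int ^ 'd \<Rightarrow> real ^ 'd" where
  "lattice_vec z = (\<chi> i. real_of_int (z $ i))"

definition walk_kernel :: "(int ^ 'd \<Rightarrow> real) \<Rightarrow> bool" where
  "walk_kernel a \<longleftrightarrow>
     (\<forall>z. a z \<ge> 0) \<and> (\<forall>z. a z = a (- z)) \<and> a 0 = 0 \<and>
     (\<forall>z. norm (lattice_vec z) = 1 \<longrightarrow> a z > 0) \<and>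
     (a has_sum 1) UNIV"

text \<open>\<open>op_A\<close> is polymorphic in the codomain because it is used both on complex-valued functions
  (spectral theory on \<open>l\<^sup>2\<close>) and on bounded real-valued functions (Markov semigroup). On either
  space the sum converges absolutely.\<close>

definition op_A ::
    "(int ^ 'd \<Rightarrow> real) \<Rightarrow> (int ^ 'd \<Rightarrow> 'b::real_normed_vector) \<Rightarrow> int ^ 'd \<Rightarrow> 'b" where
  "op_A a f x = (\<Sum>\<^sub>\<infinity>z\<in>- {0}. a z *\<^sub>R (f (x + z) - f x))"

definition a_hat :: "(int ^ 'd \<Rightarrow> real) \<Rightarrow> real ^ 'd \<Rightarrow> real" where
  "a_hat a k = (\<Sum>\<^sub>\<infinity>z. a z * cos (k \<bullet> lattice_vec z))"

definition torus :: "(real ^ 'd) set" where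
  "torus = {k. \<forall>i. - pi \<le> k $ i \<and> k $ i \<le> pi}"

text \<open>The division is in \<open>ennreal\<close>, so the integrand is \<open>\<infinity>\<close> where \<open>a_hat a k = 1\<close>; for a walk kernel
  this happens on the torus only at \<open>k = 0\<close>.\<close>

definition torus_integral :: "(int ^ 'd \<Rightarrow> real) \<Rightarrow> ennreal" where
  "torus_integral a = (\<integral>\<^sup>+k\<in>torus. 1 / ennreal (1 - a_hat a k) \<partial>lborel)"

definition l2 :: "(int ^ 'd \<Rightarrow> complex) set" where
  "l2 = {f. (\<lambda>x. (cmod (f x))\<^sup>2) summable_on UNIV}"

definition l2_norm :: "(int ^ 'd \<Rightarrow> complex) \<Rightarrow> real" where
  "l2_norm f = sqrt (\<Sum>\<^sub>\<infinity>x. (cmod (f x))\<^sup>2)"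

definition resolvent_set ::
    "((int ^ 'd \<Rightarrow> complex) \<Rightarrow> int ^ 'd \<Rightarrow> complex) \<Rightarrow> complex set" where
  "resolvent_set H =
     {\<mu>. let T = (\<lambda>f x. H f x - \<mu> * f x) in
           bij_betw T l2 l2 \<and>
           (\<exists>C. \<forall>g\<in>l2. l2_norm (inv_into l2 T g) \<le> C * l2_norm g)}"

definition spectrum ::
    "((int ^ 'd \<Rightarrow> complex) \<Rightarrow> int ^ 'd \<Rightarrow> complex) \<Rightarrow> complex set" where
  "spectrum H = - resolvent_set H"

text \<open>For a bounded self-adjoint operator the spectrum is a nonempty compact subset of the real line,
  so the maximum exists.\<close>

definition lambda0 :: "((int ^ 'd \<Rightarrow> complex) \<Rightarrow> int ^ 'd \<Rightarrow> complex) \<Rightarrow> real" where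
  "lambda0 H = (GREATEST r. complex_of_real r \<in> spectrum H)"

definition delta0 :: "int ^ 'd \<Rightarrow> real" where
  "delta0 = indicator {0}"

definition H2 ::
    "real \<Rightarrow> (int ^ 'd \<Rightarrow> real) \<Rightarrow> (int ^ 'd \<Rightarrow> complex) \<Rightarrow> int ^ 'd \<Rightarrow> complex" where
  "H2 \<kappa> a f x = (2 * \<kappa>) *\<^sub>R op_A a f x + delta0 x *\<^sub>R f x"

definition transition_function :: "(real \<Rightarrow> int ^ 'd \<Rightarrow> int ^ 'd \<Rightarrow> real) \<Rightarrow> bool" where
  "transition_function p \<longleftrightarrow>
     (\<forall>t\<ge>0. \<forall>x y. p t x y \<ge> 0) \<and>
     (\<forall>t\<ge>0. \<forall>x. (p t x has_sum 1) UNIV) \<and>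
     (\<forall>x y. p 0 x y = (if x = y then 1 else 0)) \<and>
     (\<forall>s\<ge>0. \<forall>t\<ge>0. \<forall>x z. ((\<lambda>y. p s x y * p t y z) has_sum p (s + t) x z) UNIV)"

definition semigroup_of ::
    "(real \<Rightarrow> int ^ 'd \<Rightarrow> int ^ 'd \<Rightarrow> real) \<Rightarrow> real \<Rightarrow> (int ^ 'd \<Rightarrow> real) \<Rightarrow> int ^ 'd \<Rightarrow> real" where
  "semigroup_of p t f x = (\<Sum>\<^sub>\<infinity>y. p t x y * f y)"

text \<open>The generator is the derivative at time \<open>0\<close> of the Markov semigroup on the bounded functions
  with the supremum norm. The generators considered here are bounded operators, hence everywhere
  defined on that space.\<close>

definition has_generator ::
    "(real \<Rightarrow> int ^ 'd \<Rightarrow> int ^ 'd \<Rightarrow> real) \<Rightarrow>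
     ((int ^ 'd \<Rightarrow> real) \<Rightarrow> int ^ 'd \<Rightarrow> real) \<Rightarrow> bool" where
  "has_generator p L \<longleftrightarrow>
     (\<forall>f. bounded (range f) \<longrightarrow>
        uniform_limit UNIV (\<lambda>h x. (semigroup_of p h f x - f x) / h) (L f) (at_right 0))"

definition green0 ::
    "(real \<Rightarrow> int ^ 'd \<Rightarrow> int ^ 'd \<Rightarrow> real) \<Rightarrow> int ^ 'd \<Rightarrow> int ^ 'd \<Rightarrow> ennreal" where
  "green0 p x y = (\<integral>\<^sup>+t\<in>{0..}. ennreal (p t x y) \<partial>lborel)"

definition recurrent :: "(real \<Rightarrow> int ^ 'd \<Rightarrow> int ^ 'd \<Rightarrow> real) \<Rightarrow> bool" where
  "recurrent p \<longleftrightarrow> green0 p 0 0 = \<infinity>"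

end

theory Submission
  imports Defs
begin

text \<open>Write \<open>c = 2\<kappa>\<close>, let \<open>a\<^sup>*\<^sup>n\<close> be the \<open>n\<close>-fold convolution power of \<open>a\<close>, and let
  \<open>g\<^sub>s = (\<Sum>n. a\<^sup>*\<^sup>n / (1 + s)\<^sup>n\<^sup>+\<^sup>1)\<close>, for \<open>s > 0\<close>, be the Green function of the kernel. It is a
  nonnegative element of \<open>l\<^sup>1\<close> of norm \<open>1/s\<close> with \<open>(1 + s) g\<^sub>s - a * g\<^sub>s = \<delta>\<^sub>0\<close> (\<open>green_equation\<close>).
  Everything reduces to the single function \<open>\<Gamma>(s) = g\<^sub>s(0)\<close>, which by the resolvent identity is continuous
  and strictly decreasing on \<open>(0, \<infinity>)\<close>: each of the three properties in the theorem says that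
  \<open>\<Gamma>\<close> is unbounded near \<open>0\<close>.

  Spectrum. Since \<open>H\<^sub>2\<close> is a rank-one perturbation of \<open>cA\<close>, and \<open>cs - cA\<close> is inverted on \<open>l\<^sup>2\<close> by
  convolution with \<open>g\<^sub>s/c\<close>, the number \<open>cs > 0\<close> is in the resolvent set if \<open>\<Gamma>(s) \<noteq> c\<close>
  (\<open>in_resolvent_set_H2\<close>), while \<open>g\<^sub>s\<close> is an eigenfunction if \<open>\<Gamma>(s) = c\<close>. As \<open>\<Gamma>(s) \<le> 1/s\<close>, the positive
  spectrum is a single point if \<open>\<Gamma>\<close> exceeds \<open>c\<close> somewhere, and it is empty if \<open>\<Gamma> < c\<close> throughout.
  In the latter case the maximum of the spectrum is \<open>0\<close>, because indicators of large boxes are almost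
  annihilated by \<open>H\<^sub>2\<close> (\<open>zero_in_spectrum_H2\<close>). Hence the maximum is positive for all \<open>\<kappa>\<close> exactly if
  \<open>\<Gamma>\<close> is unbounded.

  Torus integral. The Fourier transform, written \<open>~\<close>, turns \<open>green_equation\<close> into
  \<open>g\<^sub>s~(k) = 1/(s + 1 - a~(k))\<close>, so the integral of the right-hand side over the torus is \<open>(2\<pi>)\<^sup>d \<Gamma>(s)\<close>; now let \<open>s\<close> decrease to \<open>0\<close>.

  Recurrence. If \<open>T\<^sub>t\<close> is the semigroup of the walk, then \<open>e\<^sup>-\<^sup>c\<^sup>s\<^sup>t (T\<^sub>t g\<^sub>s/c)(0)\<close> has the derivative
  \<open>- e\<^sup>-\<^sup>c\<^sup>s\<^sup>t p(t,0,0)\<close>, so the Laplace transform of \<open>p(t,0,0)\<close> at \<open>cs\<close> is \<open>\<Gamma>(s)/c\<close>; again let \<open>s\<close>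
  decrease to \<open>0\<close>. No uniqueness theorem for the semigroup is needed.\<close>

text \<open>Two constants share the notation for absolute summability; summability of the norms,
  \<open>Infinite_Sum.abs_summable_on\<close>, is the one used below.\<close>

no_notation Infinite_Set_Sum.abs_summable_on (infix "abs'_summable'_on" 50)

section \<open>Convolution with summable functions\<close>

text \<open>The convolution of a real weight \<open>u\<close> with a vector-valued function \<open>f\<close>. It converges absolutely
  if \<open>u\<close> is summable and \<open>f\<close> is bounded. With \<open>f\<close> real it is the product of \<open>l\<^sup>1\<close>; with \<open>f\<close> complex
  it is the action of \<open>l\<^sup>1\<close> on \<open>l\<^sup>2\<close>. The unit is \<open>indicator {0}\<close>.\<close>

definition conv :: "('g::ab_group_add \<Rightarrow> real) \<Rightarrow> ('g \<Rightarrow> 'b::real_normed_vector) \<Rightarrow> 'g \<Rightarrow> 'b" where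
  "conv u f x = (\<Sum>\<^sub>\<infinity>y. u y *\<^sub>R f (x - y))"

lemma bij_diff_left: "bij (\<lambda>y. x - y)" for x :: "'g::ab_group_add"
  by (rule bij_betw_byWitness[where f' = "\<lambda>y. x - y"]) auto

lemma bij_diff_right: "bij (\<lambda>x. x - y)" for y :: "'g::ab_group_add"
  by (rule bij_betw_byWitness[where f' = "\<lambda>x. x + y"]) auto

lemma summable_on_abs_iff: "(\<lambda>x. \<bar>u x\<bar>) summable_on A \<longleftrightarrow> u summable_on A" for u :: "'i \<Rightarrow> real"
  using summable_on_iff_abs_summable_on_real[of u A] by simp

lemma abs_summable_scaleR_bounded:
  fixes u :: "'i \<Rightarrow> real" and f :: "'i \<Rightarrow> 'b::real_normed_vector"
  assumes "u summable_on A" and "\<And>x. norm (f x) \<le> M"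
  shows "(\<lambda>x. u x *\<^sub>R f x) abs_summable_on A"
proof (rule Infinite_Sum.abs_summable_on_comparison_test')
  show "(\<lambda>x. \<bar>u x\<bar> * M) summable_on A"
    using assms(1) by (intro summable_on_cmult_left) (simp add: summable_on_abs_iff)
  show "norm (u x *\<^sub>R f x) \<le> \<bar>u x\<bar> * M" for x
    using assms(2) by (auto intro: mult_left_mono)
qed

lemma conv_abs_summable:
  assumes "u summable_on UNIV" and "\<And>x. norm (f x) \<le> M"
  shows "(\<lambda>y. u y *\<^sub>R f (x - y)) abs_summable_on UNIV"
  by (rule abs_summable_scaleR_bounded[OF assms(1)]) (rule assms(2))

lemma conv_summable_on:
  fixes f :: "'g::ab_group_add \<Rightarrow> 'b::banach"
  assumes "u summable_on UNIV" and "\<And>x. norm (f x) \<le> M"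
  shows "(\<lambda>y. u y *\<^sub>R f (x - y)) summable_on UNIV"
  using conv_abs_summable[OF assms] by (rule abs_summable_summable)

lemma norm_conv_le:
  fixes f :: "'g::ab_group_add \<Rightarrow> 'b::banach"
  assumes "u summable_on UNIV" and "\<And>x. u x \<ge> 0" and "\<And>x. norm (f x) \<le> M"
  shows "norm (conv u f x) \<le> infsum u UNIV * M"
proof -
  have "norm (conv u f x) \<le> (\<Sum>\<^sub>\<infinity>y. norm (u y *\<^sub>R f (x - y)))"
    unfolding conv_def by (rule norm_infsum_bound[OF conv_abs_summable[OF assms(1,3)]])
  also have "\<dots> \<le> (\<Sum>\<^sub>\<infinity>y. u y * M)"
    using conv_abs_summable[OF assms(1,3)] assms
    by (intro infsum_mono summable_on_cmult_left) (auto intro: mult_left_mono)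
  also have "\<dots> = infsum u UNIV * M"
    using assms(1) by (intro infsum_cmult_left)
  finally show ?thesis .
qed

lemma summable_on_norm_le_infsum:
  fixes u :: "'i \<Rightarrow> real"
  assumes "u summable_on UNIV"
  shows "norm (u x) \<le> (\<Sum>\<^sub>\<infinity>x. \<bar>u x\<bar>)"
proof -
  have "(\<lambda>x. \<bar>u x\<bar>) summable_on UNIV"
    using assms by (simp add: summable_on_abs_iff)
  from finite_sum_le_infsum[OF this, of "{x}"] show ?thesis by simp
qed

lemma conv_add_right:
  fixes f g :: "'g::ab_group_add \<Rightarrow> 'b::banach"
  assumes "u summable_on UNIV" "\<And>x. norm (f x) \<le> M" "\<And>x. norm (g x) \<le> N"
  shows "conv u (\<lambda>x. f x + g x) x = conv u f x + conv u g x"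
  unfolding conv_def scaleR_right_distrib
  by (rule infsum_add) (rule conv_summable_on[OF assms(1,2)] conv_summable_on[OF assms(1,3)])+

lemma conv_scaleR_right: "conv u (\<lambda>x. c *\<^sub>R f x) x = c *\<^sub>R conv u f x"
  unfolding conv_def by (simp add: infsum_scaleR_right scaleR_left_commute[of _ c] del: scaleR_scaleR)

lemma conv_scaleR_left: "conv (\<lambda>x. c * u x) f x = c *\<^sub>R conv u f x"
  unfolding conv_def by (simp add: infsum_scaleR_right flip: scaleR_scaleR)

lemma conv_diff_left:
  fixes f :: "'g::ab_group_add \<Rightarrow> 'b::banach"
  assumes "u summable_on UNIV" "v summable_on UNIV" "\<And>x. norm (f x) \<le> M"
  shows "conv (\<lambda>x. u x - v x) f x = conv u f x - conv v f x"
  using infsum_add[OF conv_summable_on[OF assms(1), of f, OF assms(3), of x]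
      summable_on_uminus[THEN iffD2, OF conv_summable_on[OF assms(2), of f, OF assms(3), of x]]]
  by (simp add: conv_def scaleR_left_diff_distrib infsum_uminus)

lemma infsum_single:
  assumes "\<And>x. x \<noteq> i \<Longrightarrow> f x = 0"
  shows "infsum f UNIV = f i"
proof -
  have "infsum f UNIV = infsum f {i}"
    by (rule infsum_cong_neutral) (use assms in auto)
  then show ?thesis by simp
qed

lemma conv_indicator_left: "conv (indicator {0}) f x = f x"
  unfolding conv_def by (subst infsum_single[of 0]) (auto simp: indicator_def)

lemma conv_commute: "conv u v x = conv v u x" for u v :: "'g::ab_group_add \<Rightarrow> real"
  unfolding conv_def
  using infsum_reindex_bij_betw[OF bij_diff_left, of "\<lambda>y. u y *\<^sub>R v (x - y)" x]
  by (simp add: mult.commute)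

text \<open>The double series behind Fubini for convolutions.\<close>

lemma conv_pair_abs_summable:
  fixes u v :: "'g::ab_group_add \<Rightarrow> real"
  assumes "u summable_on UNIV" "v summable_on UNIV"
  shows "(\<lambda>(y, x). u y * v (x - y)) abs_summable_on UNIV \<times> UNIV"
proof -
  have v: "(\<lambda>x. \<bar>v (x - y)\<bar>) summable_on UNIV" "(\<Sum>\<^sub>\<infinity>x. \<bar>v (x - y)\<bar>) = (\<Sum>\<^sub>\<infinity>x. \<bar>v x\<bar>)" for y
    using summable_on_reindex_bij_betw[OF bij_diff_right, of "\<lambda>x. \<bar>v x\<bar>" y]
      infsum_reindex_bij_betw[OF bij_diff_right, of "\<lambda>x. \<bar>v x\<bar>" y] assms(2)
    by (simp_all add: summable_on_abs_iff)
  show ?thesis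
  proof (rule Infinite_Sum.abs_summable_on_Sigma_iff[THEN iffD2], intro conjI ballI)
    show "(\<lambda>x. case (y, x) of (y, x) \<Rightarrow> u y * v (x - y)) abs_summable_on UNIV" for y
      using v(1)[of y] by (simp add: abs_mult summable_on_cmult_right)
    have "(\<lambda>y. \<bar>u y\<bar> * (\<Sum>\<^sub>\<infinity>x. \<bar>v x\<bar>)) abs_summable_on UNIV"
      using assms(1) by (simp add: summable_on_abs_iff abs_mult summable_on_cmult_left)
    then show "(\<lambda>y. \<Sum>\<^sub>\<infinity>x. norm (case (y, x) of (y, x) \<Rightarrow> u y * v (x - y))) abs_summable_on UNIV"
      using v by (simp add: abs_mult infsum_cmult_right)
  qed
qed

lemma conv_summable:
  fixes u v :: "'g::ab_group_add \<Rightarrow> real"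
  assumes "u summable_on UNIV" "v summable_on UNIV"
  shows "conv u v summable_on UNIV"
proof -
  have "(\<lambda>(y, x). u y * v (x - y)) summable_on UNIV \<times> UNIV"
    using conv_pair_abs_summable[OF assms] by (rule abs_summable_summable)
  then have "(\<lambda>(x, y). u y * v (x - y)) summable_on UNIV \<times> UNIV"
    by (subst (asm) summable_on_swap) simp
  from summable_on_Sigma_banach[OF this] show ?thesis
    by (simp add: conv_def[abs_def])
qed

lemma infsum_conv:
  fixes u v :: "'g::ab_group_add \<Rightarrow> real"
  assumes "u summable_on UNIV" "v summable_on UNIV"
  shows "infsum (conv u v) UNIV = infsum u UNIV * infsum v UNIV"
proof -
  have "infsum (conv u v) UNIV = (\<Sum>\<^sub>\<infinity>x. \<Sum>\<^sub>\<infinity>y. u y * v (x - y))"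
    by (simp add: conv_def[abs_def])
  also have "\<dots> = (\<Sum>\<^sub>\<infinity>y. \<Sum>\<^sub>\<infinity>x. u y * v (x - y))"
    by (rule infsum_swap_banach[symmetric]) (rule abs_summable_summable[OF conv_pair_abs_summable[OF assms]])
  also have "\<dots> = (\<Sum>\<^sub>\<infinity>y. u y * infsum v UNIV)"
    by (intro infsum_cong)
      (simp add: infsum_cmult_right' infsum_reindex_bij_betw[OF bij_diff_right])
  also have "\<dots> = infsum u UNIV * infsum v UNIV"
    by (simp add: infsum_cmult_left')
  finally show ?thesis .
qed

lemma conv_assoc:
  fixes u v :: "'g::ab_group_add \<Rightarrow> real" and f :: "'g \<Rightarrow> 'b::banach"
  assumes u: "u summable_on UNIV" and v: "v summable_on UNIV" and f: "\<And>x. norm (f x) \<le> M"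
  shows "conv u (conv v f) x = conv (conv u v) f x"
proof -
  have *: "u y *\<^sub>R conv v f (x - y) = (\<Sum>\<^sub>\<infinity>w. (u y * v (w - y)) *\<^sub>R f (x - w))" for y
  proof -
    have "u y *\<^sub>R conv v f (x - y) = (\<Sum>\<^sub>\<infinity>z. (u y * v z) *\<^sub>R f (x - y - z))"
      unfolding conv_def by (simp add: infsum_scaleR_right flip: scaleR_scaleR)
    also have "\<dots> = (\<Sum>\<^sub>\<infinity>w. (u y * v (w - y)) *\<^sub>R f (x - w))"
      using infsum_reindex_bij_betw[OF bij_diff_right[of y],
          of "\<lambda>z. (u y * v z) *\<^sub>R f (x - y - z)"] by simp
    finally show ?thesis .
  qed
  have "(\<lambda>p. (case p of (y, w) \<Rightarrow> u y * v (w - y)) *\<^sub>R f (x - snd p)) abs_summable_on UNIV \<times> UNIV"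
    by (rule abs_summable_scaleR_bounded) (rule abs_summable_summable[OF conv_pair_abs_summable[OF u v]] f)+
  then have s: "(\<lambda>(y, w). (u y * v (w - y)) *\<^sub>R f (x - w)) summable_on UNIV \<times> UNIV"
    by (rule abs_summable_summable[THEN summable_on_cong[THEN iffD1, rotated]]) auto
  have "conv u (conv v f) x = (\<Sum>\<^sub>\<infinity>y. u y *\<^sub>R conv v f (x - y))"
    by (simp add: conv_def[of u])
  also have "\<dots> = (\<Sum>\<^sub>\<infinity>y. \<Sum>\<^sub>\<infinity>w. (u y * v (w - y)) *\<^sub>R f (x - w))"
    by (simp add: *)
  also have "\<dots> = (\<Sum>\<^sub>\<infinity>w. \<Sum>\<^sub>\<infinity>y. (u y * v (w - y)) *\<^sub>R f (x - w))"
    by (rule infsum_swap_banach[OF s])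
  also have "\<dots> = (\<Sum>\<^sub>\<infinity>w. conv u v w *\<^sub>R f (x - w))"
    using conv_summable_on[OF u, of v, OF summable_on_norm_le_infsum[OF v]]
    by (intro infsum_cong) (simp add: conv_def infsum_scaleR_left)
  finally show ?thesis by (simp add: conv_def)
qed

lemma conv_linear_combination:
  fixes f g :: "'g::ab_group_add \<Rightarrow> complex"
  assumes "u summable_on UNIV" "\<And>x. norm (f x) \<le> M" "\<And>x. norm (g x) \<le> N"
  shows "conv u (\<lambda>x. \<alpha> * f x + \<beta> * g x) x = \<alpha> * conv u f x + \<beta> * conv u g x"
proof -
  have cm: "conv u (\<lambda>x. \<gamma> * h x) x = \<gamma> * conv u h x" for \<gamma> and h :: "'g \<Rightarrow> complex"
    unfolding conv_def by (simp add: infsum_cmult_right' flip: mult_scaleR_right)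
  have "conv u (\<lambda>x. \<alpha> * f x + \<beta> * g x) x = conv u (\<lambda>x. \<alpha> * f x) x + conv u (\<lambda>x. \<beta> * g x) x"
  proof (rule conv_add_right[OF assms(1)])
    show "norm (\<alpha> * f x) \<le> norm \<alpha> * M" for x
      using assms(2) by (simp add: norm_mult mult_left_mono)
    show "norm (\<beta> * g x) \<le> norm \<beta> * N" for x
      using assms(3) by (simp add: norm_mult mult_left_mono)
  qed
  then show ?thesis by (simp add: cm)
qed

lemma conv_indicator_complex:
  fixes u :: "'g::ab_group_add \<Rightarrow> real"
  shows "conv u (\<lambda>x. complex_of_real (indicator {0} x)) x = complex_of_real (u x)"
  unfolding conv_def by (subst infsum_single[of x]) (auto simp: indicator_def scaleR_conv_of_real)

section \<open>The Green function of a probability kernel\<close>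

lemma infsum_nat_split_head:
  fixes f :: "nat \<Rightarrow> real"
  assumes "f summable_on UNIV"
  shows "infsum f UNIV = f 0 + (\<Sum>\<^sub>\<infinity>n. f (Suc n))"
proof -
  have "infsum f UNIV = infsum f (insert 0 (range Suc))"
    by (simp add: UNIV_nat_eq[symmetric])
  also have "\<dots> = f 0 + infsum f (range Suc)"
    by (rule infsum_insert) (auto intro: summable_on_subset_banach[OF assms])
  also have "infsum f (range Suc) = (\<Sum>\<^sub>\<infinity>n. f (Suc n))"
    by (subst infsum_reindex) (auto simp: o_def)
  finally show ?thesis .
qed

text \<open>The function \<open>(1 + s - a *)\<^sup>-\<^sup>1 \<delta>\<^sub>0\<close> as a Neumann series, that is, the resolvent kernel of the
  generator \<open>a * f - f\<close> at \<open>s > 0\<close>.\<close>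

definition green :: "('g::ab_group_add \<Rightarrow> real) \<Rightarrow> real \<Rightarrow> 'g \<Rightarrow> real" where
  "green a s x = (\<Sum>\<^sub>\<infinity>n. (conv a ^^ n) (indicator {0}) x / (1 + s) ^ Suc n)"

lemma product_abs_summable:
  fixes u :: "'i \<Rightarrow> real" and v :: "'j \<Rightarrow> real"
  assumes "u summable_on UNIV" "v summable_on UNIV"
  shows "(\<lambda>(y, x). u y * v x) abs_summable_on UNIV \<times> UNIV"
proof (rule Infinite_Sum.abs_summable_on_Sigma_iff[THEN iffD2], intro conjI ballI)
  show "(\<lambda>x. case (y, x) of (y, x) \<Rightarrow> u y * v x) abs_summable_on UNIV" for y
    using assms(2) by (simp add: abs_mult summable_on_cmult_right summable_on_abs_iff)
  have "(\<lambda>y. \<bar>u y\<bar> * (\<Sum>\<^sub>\<infinity>x. \<bar>v x\<bar>)) abs_summable_on UNIV"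
    using assms(1) by (simp add: summable_on_abs_iff abs_mult summable_on_cmult_left)
  then show "(\<lambda>y. \<Sum>\<^sub>\<infinity>x. norm (case (y, x) of (y, x) \<Rightarrow> u y * v x)) abs_summable_on UNIV"
    by (simp add: abs_mult infsum_cmult_right')
qed

text \<open>A probability distribution on an abelian group, without symmetry or irreducibility.\<close>

locale prob_kernel =
  fixes a :: "'g::ab_group_add \<Rightarrow> real"
  assumes nonneg: "a x \<ge> 0" and total: "(a has_sum 1) UNIV"
begin

lemma summable: "a summable_on UNIV"
  using total by (rule has_sum_imp_summable)

lemma infsum_eq_1: "infsum a UNIV = 1"
  using total by (rule infsumI)

lemma conv_nonneg: "(\<And>x. f x \<ge> 0) \<Longrightarrow> conv a f x \<ge> (0::real)"
  unfolding conv_def by (intro infsum_nonneg) (simp add: nonneg)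

text \<open>The distribution of the discrete-time walk after \<open>n\<close> steps.\<close>

definition steps :: "nat \<Rightarrow> 'g \<Rightarrow> real" where
  "steps n = (conv a ^^ n) (indicator {0})"

lemma steps_0: "steps 0 = indicator {0}"
  by (simp add: steps_def)

lemma steps_Suc: "steps (Suc n) = conv a (steps n)"
  by (simp add: steps_def)

lemma steps_nonneg: "steps n x \<ge> 0"
  by (induction n arbitrary: x) (auto simp: steps_0 steps_Suc intro: conv_nonneg)

lemma steps_has_sum: "(steps n has_sum 1) UNIV"
proof (induction n)
  case 0
  have "(indicator {0} has_sum (1::real)) {0::'g}"
    by (auto intro!: has_sum_finiteI)
  then show ?case
    unfolding steps_0 by (rule has_sum_cong_neutral[THEN iffD1, rotated -1]) auto
next
  case (Suc n)
  then show ?case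
    unfolding steps_Suc has_sum_iff
    using conv_summable[OF summable, of "steps n"] infsum_conv[OF summable, of "steps n"] infsum_eq_1
    by (auto simp: has_sum_iff)
qed

lemma steps_le_1: "steps n x \<le> 1"
  using finite_sum_le_has_sum[OF steps_has_sum[of n], of "{x}"] by (simp add: steps_nonneg)

lemma green_steps: "green a s x = (\<Sum>\<^sub>\<infinity>n. steps n x / (1 + s) ^ Suc n)"
  by (simp add: green_def steps_def)

context
  fixes s :: real
  assumes s: "s > 0"
begin

lemma geometric_summable: "(\<lambda>n. 1 / (1 + s) ^ Suc n) summable_on UNIV"
proof -
  have "summable (\<lambda>n. (1 / (1 + s)) ^ Suc n)"
    unfolding power_Suc using s by (intro summable_mult summable_geometric) auto
  then show ?thesis
    using s by (intro summable_nonneg_imp_summable_on) (auto simp: power_divide simp del: power_Suc)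
qed

lemma steps_over_power_summable: "(\<lambda>n. steps n x / (1 + s) ^ Suc n) summable_on UNIV"
proof (rule summable_on_comparison_test[OF geometric_summable])
  show "steps n x / (1 + s) ^ Suc n \<le> 1 / (1 + s) ^ Suc n" for n
    using s steps_le_1[of n x] by (intro divide_right_mono) auto
qed (use s steps_nonneg in auto)

lemma green_nonneg: "green a s x \<ge> 0"
  unfolding green_steps using s by (intro infsum_nonneg) (simp add: steps_nonneg)

lemma green_summable: "green a s summable_on UNIV"
proof -
  have "(\<lambda>(n, x). steps n x / (1 + s) ^ Suc n) abs_summable_on UNIV \<times> UNIV"
  proof (rule Infinite_Sum.abs_summable_on_Sigma_iff[THEN iffD2], intro conjI ballI)
    have *: "((\<lambda>x. steps n x / (1 + s) ^ Suc n) has_sum (1 / (1 + s) ^ Suc n)) UNIV" for n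
      by (rule has_sum_divide_const) (rule steps_has_sum)
    have eq: "norm (case (n, x) of (n, x) \<Rightarrow> steps n x / (1 + s) ^ Suc n) = steps n x / (1 + s) ^ Suc n" for n x
      using s by (simp add: steps_nonneg)
    show "(\<lambda>x. case (n, x) of (n, x) \<Rightarrow> steps n x / (1 + s) ^ Suc n) abs_summable_on UNIV" for n
      unfolding eq using * by (rule has_sum_imp_summable)
    show "(\<lambda>n. \<Sum>\<^sub>\<infinity>x. norm (case (n, x) of (n, x) \<Rightarrow> steps n x / (1 + s) ^ Suc n)) abs_summable_on UNIV"
      unfolding eq infsumI[OF *] using geometric_summable s by simp
  qed
  then have "(\<lambda>(n, x). steps n x / (1 + s) ^ Suc n) summable_on UNIV \<times> UNIV"
    by (rule abs_summable_summable)
  then have "(\<lambda>(x, n). steps n x / (1 + s) ^ Suc n) summable_on UNIV \<times> UNIV"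
    by (subst (asm) summable_on_swap) simp
  from summable_on_Sigma_banach[OF this] show ?thesis
    by (simp add: green_steps[abs_def])
qed

lemma green_equation: "(1 + s) * green a s x - conv a (green a s) x = indicator {0} x"
proof -
  \<comment> \<open>the sums over \<open>y\<close> and \<open>n\<close> may be exchanged: a product series times a factor bounded by 1\<close>
  have "(\<lambda>p. (case p of (y, n) \<Rightarrow> a y * (1 / (1 + s) ^ Suc n)) *\<^sub>R (case p of (y, n) \<Rightarrow> steps n (x - y)))
      abs_summable_on UNIV \<times> UNIV"
  proof (rule abs_summable_scaleR_bounded)
    have "(\<lambda>(y, n). a y * (1 / (1 + s) ^ Suc n)) abs_summable_on UNIV \<times> UNIV"
      by (rule product_abs_summable[OF summable geometric_summable])
    then show "(\<lambda>(y, n). a y * (1 / (1 + s) ^ Suc n)) summable_on UNIV \<times> UNIV"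
      by (rule abs_summable_summable)
    show "norm (case p of (y, n) \<Rightarrow> steps n (x - y)) \<le> 1" for p
      by (simp add: case_prod_unfold steps_nonneg steps_le_1)
  qed
  then have sw: "(\<lambda>(y, n). a y * (steps n (x - y) / (1 + s) ^ Suc n)) summable_on UNIV \<times> UNIV"
    by (rule abs_summable_summable[THEN summable_on_cong[THEN iffD1, rotated]]) auto
  have "conv a (green a s) x = (\<Sum>\<^sub>\<infinity>y. \<Sum>\<^sub>\<infinity>n. a y * (steps n (x - y) / (1 + s) ^ Suc n))"
    by (simp add: conv_def green_steps infsum_cmult_right' del: power_Suc times_divide_eq_right)
  also have "\<dots> = (\<Sum>\<^sub>\<infinity>n. \<Sum>\<^sub>\<infinity>y. a y * (steps n (x - y) / (1 + s) ^ Suc n))"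
    by (rule infsum_swap_banach[OF sw])
  also have "\<dots> = (\<Sum>\<^sub>\<infinity>n. steps (Suc n) x / (1 + s) ^ Suc n)"
  proof (rule infsum_cong)
    fix n
    have "(\<Sum>\<^sub>\<infinity>y. a y * (steps n (x - y) / (1 + s) ^ Suc n)) =
        (\<Sum>\<^sub>\<infinity>y. (a y * steps n (x - y)) * inverse ((1 + s) ^ Suc n))"
      by (simp add: divide_inverse mult.assoc)
    then show "(\<Sum>\<^sub>\<infinity>y. a y * (steps n (x - y) / (1 + s) ^ Suc n)) = steps (Suc n) x / (1 + s) ^ Suc n"
      by (simp add: infsum_cmult_left' steps_Suc conv_def divide_inverse del: power_Suc)
  qed
  finally have A: "conv a (green a s) x = (\<Sum>\<^sub>\<infinity>n. steps (Suc n) x / (1 + s) ^ Suc n)" .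
  have "(1 + s) * green a s x = (\<Sum>\<^sub>\<infinity>n. (1 + s) * (steps n x / (1 + s) ^ Suc n))"
    by (simp add: green_steps infsum_cmult_right' del: power_Suc times_divide_eq_right)
  also have "\<dots> = (\<Sum>\<^sub>\<infinity>n. steps n x / (1 + s) ^ n)"
    using s by (intro infsum_cong) simp
  also have "\<dots> = steps 0 x + (\<Sum>\<^sub>\<infinity>n. steps (Suc n) x / (1 + s) ^ Suc n)"
  proof (subst infsum_nat_split_head)
    have "(\<lambda>n. (1 + s) * (steps n x / (1 + s) ^ Suc n)) summable_on UNIV"
      by (intro summable_on_cmult_right steps_over_power_summable)
    then show "(\<lambda>n. steps n x / (1 + s) ^ n) summable_on UNIV"
      using s by simp
  qed simp
  finally show ?thesis
    by (simp add: A steps_0)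
qed

lemma green_infsum: "infsum (green a s) UNIV = 1 / s"
proof -
  have "(1 + s) * infsum (green a s) UNIV = infsum (\<lambda>x. (1 + s) * green a s x) UNIV"
    by (rule infsum_cmult_right'[symmetric])
  also have "\<dots> = infsum (\<lambda>x. steps 0 x + conv a (green a s) x) UNIV"
    using green_equation by (intro infsum_cong) (simp add: steps_0 algebra_simps)
  also have "\<dots> = 1 + infsum (green a s) UNIV"
    using steps_has_sum[of 0] conv_summable[OF summable green_summable]
      infsum_conv[OF summable green_summable] infsum_eq_1
    by (subst infsum_add) (auto simp: has_sum_iff)
  finally show ?thesis
    using s by (simp add: field_simps)
qed

lemma green_le: "green a s x \<le> 1 / s"
  using finite_sum_le_infsum[OF green_summable, of "{x}"] by (simp add: green_infsum green_nonneg)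

lemma green_0_pos: "green a s 0 > 0"
proof -
  have "(1 + s) * green a s 0 = 1 + conv a (green a s) 0"
    using green_equation[of 0] by simp
  moreover have "conv a (green a s) 0 \<ge> 0"
    by (intro conv_nonneg green_nonneg)
  ultimately have "0 < (1 + s) * green a s 0"
    by linarith
  then show ?thesis
    using s by (simp add: zero_less_mult_iff)
qed

end

lemma norm_green_le: "s > 0 \<Longrightarrow> norm (green a s x) \<le> 1 / s"
  by (simp add: green_nonneg green_le)

text \<open>Both sides come from \<open>green_equation\<close> convolved with the other Green function. This identity
  yields the monotonicity and the continuity of \<open>\<Gamma>\<close>.\<close>

lemma resolvent_identity:
  assumes s: "s > 0" and r: "r > 0"
  shows "green a s x - green a r x = (r - s) * conv (green a s) (green a r) x"
proof -
  note sum = green_summable[OF s] green_summable[OF r] summable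
  have *: "green a q x = (1 + t) * conv (green a q) (green a t) x - conv (conv a (green a t)) (green a q) x"
    if q: "q > 0" and t: "t > 0" for q t
  proof -
    have "green a q x = conv (\<lambda>y. (1 + t) * green a t y - conv a (green a t) y) (green a q) x"
      unfolding green_equation[OF t] by (simp add: conv_indicator_left)
    also have "\<dots> = (1 + t) * conv (green a t) (green a q) x - conv (conv a (green a t)) (green a q) x"
      by (subst conv_diff_left[where M = "1 / q"])
        (auto intro!: summable_on_cmult_right green_summable t conv_summable summable
          norm_green_le[OF q, simplified] simp: conv_scaleR_left)
    finally show ?thesis
      by (simp add: conv_commute[of "green a t"])
  qed
  have "conv (conv a (green a r)) (green a s) x = conv a (conv (green a r) (green a s)) x"
    by (rule conv_assoc[OF sum(3,2) norm_green_le[OF s], symmetric])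
  also have "conv (green a r) (green a s) = conv (green a s) (green a r)"
    by (rule ext) (rule conv_commute)
  also have "conv a (conv (green a s) (green a r)) x = conv (conv a (green a s)) (green a r) x"
    by (rule conv_assoc[OF sum(3,1) norm_green_le[OF r]])
  finally show ?thesis
    using *[OF s r] *[OF r s] conv_commute[of "green a r" "green a s" x]
    by (simp add: algebra_simps)
qed

lemma green_0_decreasing:
  assumes "0 < s" "s < r"
  shows "green a r 0 < green a s 0"
proof -
  have r: "r > 0" using assms by simp
  have "(\<lambda>y. green a s y *\<^sub>R green a r (0 - y)) summable_on UNIV"
    by (rule conv_summable_on[OF green_summable norm_green_le]) (use assms in auto)
  from finite_sum_le_infsum[OF this, of "{0}"]
  have "green a s 0 * green a r 0 \<le> conv (green a s) (green a r) 0"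
    using assms by (simp add: conv_def green_nonneg)
  moreover have "0 < green a s 0 * green a r 0"
    using assms by (simp add: green_0_pos)
  ultimately have "0 < (r - s) * conv (green a s) (green a r) 0"
    using assms by simp
  then show ?thesis
    using resolvent_identity[OF assms(1) r, of 0] by simp
qed

lemma green_0_continuous: "continuous_on {0<..} (\<lambda>s. green a s 0)"
proof -
  have "isCont (\<lambda>s. green a s 0) t" if t: "t > 0" for t
  proof -
    have lip: "norm (green a r 0 - green a s 0) \<le> (4 / (t * t)) * norm (r - s)"
      if "r \<in> {t / 2<..}" "s \<in> {t / 2<..}" for r s
    proof -
      have rs: "r > 0" "s > 0" using that t by auto
      have "norm (conv (green a r) (green a s) 0) \<le> (1 / r) * (1 / s)"
        using norm_conv_le[OF green_summable[OF rs(1)] green_nonneg[OF rs(1)] norm_green_le[OF rs(2)], where x = 0] rs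
        by (simp add: green_infsum)
      also have "\<dots> \<le> (2 / t) * (2 / t)"
        using that t by (intro mult_mono) (auto simp: field_simps)
      finally have c: "norm (conv (green a r) (green a s) 0) \<le> 4 / (t * t)"
        by simp
      have "norm (green a r 0 - green a s 0) = norm (s - r) * norm (conv (green a r) (green a s) 0)"
        by (simp add: resolvent_identity[OF rs] abs_mult)
      also have "\<dots> \<le> norm (s - r) * (4 / (t * t))"
        by (intro mult_left_mono c) auto
      finally show ?thesis
        by (simp add: abs_minus_commute mult.commute)
    qed
    have "(4 / (t * t))-lipschitz_on {t / 2<..} (\<lambda>s. green a s 0)"
      by (rule lipschitz_onI) (use lip t in \<open>auto simp: dist_norm\<close>)
    then have "continuous_on {t / 2<..} (\<lambda>s. green a s 0)"
      by (rule lipschitz_on_continuous_on)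
    then show ?thesis
      using t by (simp add: continuous_on_eq_continuous_at)
  qed
  then show ?thesis
    by (simp add: continuous_at_imp_continuous_on)
qed

lemma green_right_inverse:
  fixes f :: "'g \<Rightarrow> complex"
  assumes s: "s > 0" and f: "\<And>x. norm (f x) \<le> M"
  shows "(1 + s) *\<^sub>R conv (green a s) f x - conv a (conv (green a s) f) x = f x"
proof -
  note sum = green_summable[OF s] summable
  have "(1 + s) *\<^sub>R conv (green a s) f x - conv a (conv (green a s) f) x =
      conv (\<lambda>y. (1 + s) * green a s y - conv a (green a s) y) f x"
    by (subst conv_diff_left[where M = M])
      (auto intro!: summable_on_cmult_right conv_summable sum f simp: conv_scaleR_left conv_assoc[OF sum(2,1) f])
  then show ?thesis
    unfolding green_equation[OF s] by (simp add: conv_indicator_left)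
qed

lemma green_left_inverse:
  fixes f :: "'g \<Rightarrow> complex"
  assumes s: "s > 0" and f: "\<And>x. norm (f x) \<le> M"
  shows "conv (green a s) (\<lambda>x. (1 + s) *\<^sub>R f x - conv a f x) x = f x"
proof -
  note sum = green_summable[OF s] summable
  have af: "norm (conv a f x) \<le> M" for x
  proof -
    have "norm (conv a f x) \<le> infsum a UNIV * M"
      by (rule norm_conv_le[OF summable nonneg f])
    then show ?thesis by (simp add: infsum_eq_1)
  qed
  have "conv (green a s) (\<lambda>x. (1 + s) *\<^sub>R f x - conv a f x) x =
      conv (green a s) (\<lambda>x. complex_of_real (1 + s) * f x + (-1) * conv a f x) x"
    by (simp add: scaleR_conv_of_real)
  also have "\<dots> = complex_of_real (1 + s) * conv (green a s) f x + (-1) * conv (green a s) (conv a f) x"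
    by (rule conv_linear_combination[OF sum(1) f af])
  also have "conv (green a s) (conv a f) x = conv (conv (green a s) a) f x"
    by (rule conv_assoc[OF sum f])
  also have "conv (green a s) a = conv a (green a s)"
    by (rule ext) (rule conv_commute)
  also have "conv (conv a (green a s)) f x = conv a (conv (green a s) f) x"
    by (rule conv_assoc[OF sum(2,1) f, symmetric])
  finally show ?thesis
    using green_right_inverse[of s f M x, OF s f] by (simp add: scaleR_conv_of_real)
qed

end

section \<open>Square-summable functions\<close>

text \<open>Cauchy--Schwarz for a finite measure with weights \<open>u\<close>, obtained by expanding the variance-like
  sum \<open>\<Sum>u (U \<phi> - m)\<^sup>2 \<ge> 0\<close>, where \<open>m = \<Sum>u \<phi>\<close>.\<close>

lemma weighted_cauchy_schwarz:
  fixes u \<phi> :: "'i \<Rightarrow> real"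
  assumes u: "(u has_sum U) UNIV" and nn: "\<And>y. u y \<ge> 0" and U: "U > 0"
    and bd: "\<And>y. norm (\<phi> y) \<le> M"
  shows "(\<Sum>\<^sub>\<infinity>y. u y * \<phi> y)\<^sup>2 \<le> U * (\<Sum>\<^sub>\<infinity>y. u y * (\<phi> y)\<^sup>2)"
proof -
  define m where "m = (\<Sum>\<^sub>\<infinity>y. u y * \<phi> y)"
  define X where "X = (\<Sum>\<^sub>\<infinity>y. u y * (\<phi> y)\<^sup>2)"
  have su: "u summable_on UNIV" using u by (rule has_sum_imp_summable)
  have 1: "((\<lambda>y. u y * \<phi> y) has_sum m) UNIV"
    unfolding m_def using abs_summable_summable[OF abs_summable_scaleR_bounded[OF su bd]]
    by (intro has_sum_infsum) simp
  have "norm ((\<phi> y)\<^sup>2) \<le> M\<^sup>2" for y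
    using power_mono[OF bd, of y 2] by simp
  from abs_summable_summable[OF abs_summable_scaleR_bounded[OF su this]]
  have 2: "((\<lambda>y. u y * (\<phi> y)\<^sup>2) has_sum X) UNIV"
    unfolding X_def by (intro has_sum_infsum) simp
  have "((\<lambda>y. U\<^sup>2 * (u y * (\<phi> y)\<^sup>2) + (- 2 * U * m) * (u y * \<phi> y) + m\<^sup>2 * u y)
      has_sum (U\<^sup>2 * X + (- 2 * U * m) * m + m\<^sup>2 * U)) UNIV"
    by (intro has_sum_add has_sum_cmult_right 1 2 u)
  also have "(\<lambda>y. U\<^sup>2 * (u y * (\<phi> y)\<^sup>2) + (- 2 * U * m) * (u y * \<phi> y) + m\<^sup>2 * u y) =
      (\<lambda>y. u y * (U * \<phi> y - m)\<^sup>2)"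
    by (simp add: power2_eq_square algebra_simps)
  finally have "U\<^sup>2 * X + (- 2 * U * m) * m + m\<^sup>2 * U \<ge> 0"
    by (rule has_sum_nonneg) (simp add: nn)
  then have "0 \<le> U * (U * X - m\<^sup>2)"
    by (simp add: power2_eq_square algebra_simps)
  then have "0 \<le> U * X - m\<^sup>2"
    using U by (simp add: zero_le_mult_iff)
  then show ?thesis
    by (simp add: m_def X_def)
qed

lemma norm_le_of_square_summable:
  fixes f :: "'i \<Rightarrow> 'b::real_normed_vector"
  assumes "(\<lambda>x. (norm (f x))\<^sup>2) summable_on UNIV"
  shows "(norm (f x))\<^sup>2 \<le> (\<Sum>\<^sub>\<infinity>x. (norm (f x))\<^sup>2)"
    and "norm (f x) \<le> sqrt (\<Sum>\<^sub>\<infinity>x. (norm (f x))\<^sup>2)"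
proof -
  show "(norm (f x))\<^sup>2 \<le> (\<Sum>\<^sub>\<infinity>x. (norm (f x))\<^sup>2)"
    using finite_sum_le_infsum[OF assms, of "{x}"] by simp
  then show "norm (f x) \<le> sqrt (\<Sum>\<^sub>\<infinity>x. (norm (f x))\<^sup>2)"
    by (rule real_le_rsqrt)
qed

text \<open>Young's inequality \<open>\<parallel>u * f\<parallel>\<^sub>2 \<le> \<parallel>u\<parallel>\<^sub>1 \<parallel>f\<parallel>\<^sub>2\<close>, squared. The weighted Cauchy--Schwarz inequality bounds
  \<open>\<bar>u * f\<bar>\<^sup>2\<close> pointwise by \<open>U\<close> times the \<open>l\<^sup>1\<close> convolution of \<open>u\<close> with \<open>\<bar>f\<bar>\<^sup>2\<close>.\<close>

lemma young_l2:
  fixes f :: "'g::ab_group_add \<Rightarrow> 'b::banach"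
  assumes u: "(u has_sum U) UNIV" and nn: "\<And>y. u y \<ge> 0" and U: "U > 0"
    and f: "(\<lambda>x. (norm (f x))\<^sup>2) summable_on UNIV"
  shows "(\<lambda>x. (norm (conv u f x))\<^sup>2) summable_on UNIV"
    and "(\<Sum>\<^sub>\<infinity>x. (norm (conv u f x))\<^sup>2) \<le> U\<^sup>2 * (\<Sum>\<^sub>\<infinity>x. (norm (f x))\<^sup>2)"
proof -
  have su: "u summable_on UNIV" using u by (rule has_sum_imp_summable)
  note bd = norm_le_of_square_summable(2)[OF f]
  have le: "(norm (conv u f x))\<^sup>2 \<le> U * conv u (\<lambda>x. (norm (f x))\<^sup>2) x" for x
  proof -
    have "norm (conv u f x) \<le> (\<Sum>\<^sub>\<infinity>y. norm (u y *\<^sub>R f (x - y)))"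
      unfolding conv_def by (rule norm_infsum_bound[OF conv_abs_summable[OF su bd]])
    also have "\<dots> = (\<Sum>\<^sub>\<infinity>y. u y * norm (f (x - y)))"
      by (simp add: nn)
    finally have "(norm (conv u f x))\<^sup>2 \<le> (\<Sum>\<^sub>\<infinity>y. u y * norm (f (x - y)))\<^sup>2"
      by (intro power_mono) auto
    also have "\<dots> \<le> U * (\<Sum>\<^sub>\<infinity>y. u y * (norm (f (x - y)))\<^sup>2)"
      by (rule weighted_cauchy_schwarz[OF u nn U]) (use bd in simp)
    finally show ?thesis by (simp add: conv_def)
  qed
  have s: "(\<lambda>x. U * conv u (\<lambda>x. (norm (f x))\<^sup>2) x) summable_on UNIV"
    by (intro summable_on_cmult_right conv_summable su f)
  then show *: "(\<lambda>x. (norm (conv u f x))\<^sup>2) summable_on UNIV"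
    by (rule summable_on_comparison_test) (use le in auto)
  have "(\<Sum>\<^sub>\<infinity>x. (norm (conv u f x))\<^sup>2) \<le> (\<Sum>\<^sub>\<infinity>x. U * conv u (\<lambda>x. (norm (f x))\<^sup>2) x)"
    by (intro infsum_mono * s le)
  also have "\<dots> = U\<^sup>2 * (\<Sum>\<^sub>\<infinity>x. (norm (f x))\<^sup>2)"
    using infsum_conv[OF su f] infsumI[OF u] by (simp add: infsum_cmult_right' power2_eq_square)
  finally show "(\<Sum>\<^sub>\<infinity>x. (norm (conv u f x))\<^sup>2) \<le> U\<^sup>2 * (\<Sum>\<^sub>\<infinity>x. (norm (f x))\<^sup>2)" .
qed

lemma l2_norm_nonneg: "l2_norm f \<ge> 0"
  by (simp add: l2_norm_def infsum_nonneg)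

lemma l2_norm_power2: "(l2_norm f)\<^sup>2 = (\<Sum>\<^sub>\<infinity>x. (cmod (f x))\<^sup>2)"
  by (simp add: l2_norm_def infsum_nonneg)

lemma cmod_le_l2_norm: "f \<in> l2 \<Longrightarrow> cmod (f x) \<le> l2_norm f"
  unfolding l2_def l2_norm_def by (rule norm_le_of_square_summable(2)) simp

text \<open>The bound with the factor 2 replaces the triangle inequality; constants do not matter below.\<close>

lemma l2_add:
  assumes f: "f \<in> l2" and g: "g \<in> l2"
  shows "(\<lambda>x. f x + g x) \<in> l2"
    and "(l2_norm (\<lambda>x. f x + g x))\<^sup>2 \<le> 2 * (l2_norm f)\<^sup>2 + 2 * (l2_norm g)\<^sup>2"
proof -
  have le: "(cmod (f x + g x))\<^sup>2 \<le> 2 * (cmod (f x))\<^sup>2 + 2 * (cmod (g x))\<^sup>2" for x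
  proof -
    have "(cmod (f x + g x))\<^sup>2 \<le> (cmod (f x) + cmod (g x))\<^sup>2"
      by (intro power_mono norm_triangle_ineq) auto
    also have "\<dots> \<le> 2 * (cmod (f x))\<^sup>2 + 2 * (cmod (g x))\<^sup>2"
      using sum_squares_bound[of "cmod (f x)" "cmod (g x)"] by (simp add: power2_sum)
    finally show ?thesis .
  qed
  have s: "(\<lambda>x. 2 * (cmod (f x))\<^sup>2) summable_on UNIV" "(\<lambda>x. 2 * (cmod (g x))\<^sup>2) summable_on UNIV"
    using f g by (auto simp: l2_def intro!: summable_on_cmult_right)
  note s' = summable_on_add[OF s]
  have *: "(\<lambda>x. (cmod (f x + g x))\<^sup>2) summable_on UNIV"
    by (rule summable_on_comparison_test[OF s']) (use le in auto)
  then show "(\<lambda>x. f x + g x) \<in> l2"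
    by (simp add: l2_def)
  have "(\<Sum>\<^sub>\<infinity>x. (cmod (f x + g x))\<^sup>2) \<le> (\<Sum>\<^sub>\<infinity>x. 2 * (cmod (f x))\<^sup>2 + 2 * (cmod (g x))\<^sup>2)"
    by (intro infsum_mono * s' le)
  then show "(l2_norm (\<lambda>x. f x + g x))\<^sup>2 \<le> 2 * (l2_norm f)\<^sup>2 + 2 * (l2_norm g)\<^sup>2"
    by (simp add: l2_norm_power2 infsum_add[OF s] infsum_cmult_right')
qed

lemma l2_cmult:
  assumes "f \<in> l2"
  shows "(\<lambda>x. \<alpha> * f x) \<in> l2" and "l2_norm (\<lambda>x. \<alpha> * f x) = cmod \<alpha> * l2_norm f"
  using assms
  by (simp_all add: l2_def l2_norm_def norm_mult power_mult_distrib infsum_cmult_right'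
      summable_on_cmult_right real_sqrt_mult)

lemma l2_conv:
  assumes u: "(u has_sum U) UNIV" and nn: "\<And>y. u y \<ge> 0" and U: "U > 0" and f: "f \<in> l2"
  shows "conv u f \<in> l2" and "l2_norm (conv u f) \<le> U * l2_norm f"
proof -
  have f': "(\<lambda>x. (cmod (f x))\<^sup>2) summable_on UNIV" using f by (simp add: l2_def)
  show "conv u f \<in> l2"
    using young_l2(1)[OF u nn U f'] by (simp add: l2_def)
  show "l2_norm (conv u f) \<le> U * l2_norm f"
  proof (rule power2_le_imp_le)
    show "(l2_norm (conv u f))\<^sup>2 \<le> (U * l2_norm f)\<^sup>2"
      using young_l2(2)[OF u nn U f'] by (simp add: l2_norm_power2 power_mult_distrib)
    show "0 \<le> U * l2_norm f"
      using U by (simp add: l2_norm_nonneg)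
  qed
qed

lemma l2_indicator:
  assumes "finite B"
  shows "(\<lambda>x. complex_of_real (indicator B x)) \<in> l2"
    and "(l2_norm (\<lambda>x. complex_of_real (indicator B x)))\<^sup>2 = real (card B)"
proof -
  have "((\<lambda>x. 1) has_sum real (card B)) B"
    using assms by (intro has_sum_finiteI) auto
  then have "((\<lambda>x. (cmod (complex_of_real (indicator B x)))\<^sup>2) has_sum real (card B)) UNIV"
    by (rule has_sum_cong_neutral[THEN iffD1, rotated -1]) auto
  then show "(\<lambda>x. complex_of_real (indicator B x)) \<in> l2"
    and "(l2_norm (\<lambda>x. complex_of_real (indicator B x)))\<^sup>2 = real (card B)"
    by (auto simp: l2_def l2_norm_power2 has_sum_iff)
qed

lemma l2_delta0:
  assumes "f \<in> l2"
  shows "(\<lambda>x. complex_of_real (delta0 x) * f x) \<in> l2"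
    and "l2_norm (\<lambda>x. complex_of_real (delta0 x) * f x) = cmod (f 0)"
proof -
  have eq: "(\<lambda>x. complex_of_real (delta0 x) * f x) = (\<lambda>x. f 0 * complex_of_real (indicator {0} x))"
    by (auto simp: delta0_def indicator_def)
  have 1: "l2_norm (\<lambda>x::int ^ 'a. complex_of_real (indicator {0} x)) = 1"
  proof -
    have "(l2_norm (\<lambda>x::int ^ 'a. complex_of_real (indicator {0} x)))\<^sup>2 = 1\<^sup>2"
      by (subst l2_indicator(2)) auto
    then show ?thesis
      by (rule power2_eq_imp_eq) (auto simp: l2_norm_nonneg)
  qed
  show "(\<lambda>x. complex_of_real (delta0 x) * f x) \<in> l2"
    unfolding eq by (intro l2_cmult l2_indicator) simp
  show "l2_norm (\<lambda>x. complex_of_real (delta0 x) * f x) = cmod (f 0)"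
    unfolding eq by (subst l2_cmult(2)) (auto simp: l2_indicator 1)
qed

section \<open>The positive spectrum of the rank-one perturbation\<close>

lemma walk_kernel_prob_kernel: "walk_kernel a \<Longrightarrow> prob_kernel a"
  by (simp add: walk_kernel_def prob_kernel_def)

text \<open>The symmetry of \<open>a\<close> turns the sum over \<open>f (x + z)\<close> into a convolution.\<close>

lemma op_A_eq_conv:
  fixes f :: "int ^ 'd \<Rightarrow> 'b::banach"
  assumes a: "walk_kernel a" and f: "\<And>x. norm (f x) \<le> M"
  shows "op_A a f x = conv a f x - f x"
proof -
  interpret prob_kernel a using a by (rule walk_kernel_prob_kernel)
  have a0: "a 0 = 0" and sym: "a (- z) = a z" for z
    using a by (simp_all add: walk_kernel_def)
  have s: "(\<lambda>z. a z *\<^sub>R f (x + z)) summable_on UNIV"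
    by (rule abs_summable_summable[OF abs_summable_scaleR_bounded[OF summable f]])
  have "op_A a f x = (\<Sum>\<^sub>\<infinity>z. a z *\<^sub>R (f (x + z) - f x))"
    unfolding op_A_def by (rule infsum_cong_neutral) (auto simp: a0)
  also have "\<dots> = (\<Sum>\<^sub>\<infinity>z. a z *\<^sub>R f (x + z) + - (a z *\<^sub>R f x))"
    by (simp add: scaleR_right_diff_distrib)
  also have "\<dots> = (\<Sum>\<^sub>\<infinity>z. a z *\<^sub>R f (x + z)) - (\<Sum>\<^sub>\<infinity>z. a z *\<^sub>R f x)"
    by (subst infsum_add) (auto intro!: s summable_on_scaleR_left summable simp: summable_on_uminus infsum_uminus)
  also have "(\<Sum>\<^sub>\<infinity>z. a z *\<^sub>R f x) = f x"
    by (subst infsum_scaleR_left) (auto simp: summable infsum_eq_1)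
  also have "(\<Sum>\<^sub>\<infinity>z. a z *\<^sub>R f (x + z)) = conv a f x"
    unfolding conv_def
    using infsum_reindex_bij_betw[OF bij_uminus, of "\<lambda>z. a z *\<^sub>R f (x + z)"] by (simp add: sym)
  finally show ?thesis .
qed

text \<open>Points outside the resolvent set are recognised by exact or approximate eigenfunctions.\<close>

lemma resolvent_set_bounded_below:
  assumes "\<mu> \<in> resolvent_set H"
  obtains C where "\<And>f. f \<in> l2 \<Longrightarrow> l2_norm f \<le> C * l2_norm (\<lambda>x. H f x - \<mu> * f x)"
proof -
  let ?T = "\<lambda>f x. H f x - \<mu> * f x"
  from assms obtain C where bij: "bij_betw ?T l2 l2"
    and C: "\<And>g. g \<in> l2 \<Longrightarrow> l2_norm (inv_into l2 ?T g) \<le> C * l2_norm g"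
    by (auto simp: resolvent_set_def Let_def)
  have "l2_norm f \<le> C * l2_norm (?T f)" if "f \<in> l2" for f
    using C[OF bij_betw_apply[OF bij that]]
    unfolding inv_into_f_f[OF bij_betw_imp_inj_on[OF bij] that] .
  then show ?thesis by (rule that)
qed

lemma resolvent_setI:
  assumes T: "\<And>f. f \<in> l2 \<Longrightarrow> (\<lambda>x. H f x - \<mu> * f x) \<in> l2"
    and S: "\<And>h. h \<in> l2 \<Longrightarrow> S h \<in> l2"
    and ST: "\<And>f. f \<in> l2 \<Longrightarrow> S (\<lambda>x. H f x - \<mu> * f x) = f"
    and TS: "\<And>h x. h \<in> l2 \<Longrightarrow> H (S h) x - \<mu> * S h x = h x"
    and bound: "\<And>h. h \<in> l2 \<Longrightarrow> l2_norm (S h) \<le> C * l2_norm h"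
  shows "\<mu> \<in> resolvent_set H"
proof -
  let ?T = "\<lambda>f x. H f x - \<mu> * f x"
  have bij: "bij_betw ?T l2 l2"
    by (rule bij_betw_byWitness[where f' = S]) (use T S ST TS in auto)
  have "inv_into l2 ?T h = S h" if "h \<in> l2" for h
    by (rule inv_into_f_eq[OF bij_betw_imp_inj_on[OF bij]]) (use S TS that in auto)
  then show ?thesis
    using bij bound by (auto simp: resolvent_set_def Let_def)
qed

text \<open>Every point is written as \<open>2\<kappa>s\<close>, so that \<open>s\<close> is the spectral parameter of \<open>a * f - f\<close>.\<close>

lemma H2_shifted_eq:
  assumes a: "walk_kernel a" and f: "f \<in> l2" and \<kappa>: "\<kappa> > 0"
  shows "H2 \<kappa> a f x - complex_of_real (2 * \<kappa> * s) * f x =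
    complex_of_real (delta0 x) * f x - complex_of_real (2 * \<kappa>) * ((1 + s) *\<^sub>R f x - conv a f x)"
  unfolding H2_def op_A_eq_conv[OF a cmod_le_l2_norm[OF f]]
  by (simp add: scaleR_conv_of_real algebra_simps)

text \<open>With \<open>R\<close> the convolution with \<open>g\<^sub>s\<close>, the equation \<open>(H\<^sub>2 - cs) f = h\<close> is equivalent to
  \<open>f = R ((f(0) \<delta>\<^sub>0 - h)/c)\<close>, and its value at the origin determines
  \<open>f(0) = (R h)(0) / (\<Gamma>(s) - c)\<close>.\<close>

lemma in_resolvent_set_H2:
  fixes a :: "int ^ 'd \<Rightarrow> real"
  assumes a: "walk_kernel a" and \<kappa>: "\<kappa> > 0" and s: "s > 0" and ne: "green a s 0 \<noteq> 2 * \<kappa>"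
  shows "complex_of_real (2 * \<kappa> * s) \<in> resolvent_set (H2 \<kappa> a)"
proof -
  interpret prob_kernel a using a by (rule walk_kernel_prob_kernel)
  define c where "c = 2 * \<kappa>"
  define R where "R = (conv (green a s) :: (int ^ 'd \<Rightarrow> complex) \<Rightarrow> int ^ 'd \<Rightarrow> complex)"
  define d :: "int ^ 'd \<Rightarrow> complex" where "d x = complex_of_real (delta0 x)" for x
  \<comment> \<open>the value at the origin of the solution\<close>
  define \<phi> where "\<phi> h = R h 0 / complex_of_real (green a s 0 - c)" for h
  define w where "w h x = \<phi> h / complex_of_real c * d x + (- 1 / complex_of_real c) * h x" for h x
  have c: "c > 0" using \<kappa> by (simp add: c_def)
  have c_ne: "complex_of_real c \<noteq> 0" using c by simp
  have \<Gamma>_ne: "complex_of_real (green a s 0 - c) \<noteq> 0"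
    using ne unfolding of_real_eq_0_iff by (simp add: c_def)
  have hs: "(green a s has_sum (1 / s)) UNIV"
    using green_summable[OF s] green_infsum[OF s] by (simp add: has_sum_iff)
  have d_ind: "d = (\<lambda>x. complex_of_real (indicator {0} x))"
    by (simp add: d_def[abs_def] delta0_def)
  have d: "d \<in> l2" "(l2_norm d)\<^sup>2 = 1"
    unfolding d_ind using l2_indicator[of "{0 :: int ^ 'd}"] by simp_all
  have Rd: "R d x = complex_of_real (green a s x)" for x
    unfolding R_def d_ind by (rule conv_indicator_complex)
  have R: "R h \<in> l2" "l2_norm (R h) \<le> 1 / s * l2_norm h" if "h \<in> l2" for h
    unfolding R_def using l2_conv[OF hs green_nonneg[OF s] _ that] s by simp_all
  have R_lin: "R (\<lambda>x. \<alpha> * f x + \<beta> * g x) x = \<alpha> * R f x + \<beta> * R g x"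
    if "f \<in> l2" "g \<in> l2" for \<alpha> \<beta> f g x
    unfolding R_def
    by (rule conv_linear_combination[OF green_summable[OF s] cmod_le_l2_norm[OF that(1)] cmod_le_l2_norm[OF that(2)]])
  have w: "w h \<in> l2" if "h \<in> l2" for h
    unfolding w_def[abs_def] by (intro l2_add(1) l2_cmult(1) d(1) that)
  have T: "H2 \<kappa> a f x - complex_of_real (2 * \<kappa> * s) * f x =
      f 0 * d x + (- complex_of_real c) * ((1 + s) *\<^sub>R f x - conv a f x)" if "f \<in> l2" for f x
    using H2_shifted_eq[OF a that \<kappa>, of x s] by (simp add: c_def d_ind delta0_def indicator_def)
  have u: "(\<lambda>x. (1 + s) *\<^sub>R f x - conv a f x) \<in> l2" if "f \<in> l2" for f
  proof -
    have "(\<lambda>x. complex_of_real (1 + s) * f x + (- 1) * conv a f x) \<in> l2"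
      by (intro l2_add(1) l2_cmult(1) that l2_conv(1)[OF total nonneg]) simp
    then show ?thesis by (simp add: scaleR_conv_of_real)
  qed
  show ?thesis
  proof (rule resolvent_setI[where S = "\<lambda>h. R (w h)"])
    show "(\<lambda>x. H2 \<kappa> a f x - complex_of_real (2 * \<kappa> * s) * f x) \<in> l2" if "f \<in> l2" for f
      unfolding T[OF that] by (intro l2_add(1) l2_cmult(1) d(1) u that)
    show "R (w h) \<in> l2" if "h \<in> l2" for h
      by (intro R w that)
    show "R (w (\<lambda>x. H2 \<kappa> a f x - complex_of_real (2 * \<kappa> * s) * f x)) = f" if f: "f \<in> l2" for f
    proof -
      let ?u = "\<lambda>x. (1 + s) *\<^sub>R f x - conv a f x"
      let ?h = "\<lambda>x. f 0 * d x + (- complex_of_real c) * ?u x"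
      have Ru: "R ?u x = f x" for x
        unfolding R_def by (rule green_left_inverse[OF s cmod_le_l2_norm[OF f]])
      have "R ?h 0 = f 0 * complex_of_real (green a s 0 - c)"
        unfolding R_lin[OF d(1) u[OF f]] Rd Ru by (simp add: algebra_simps)
      then have \<phi>: "\<phi> ?h = f 0"
        unfolding \<phi>_def by (simp only:) (use \<Gamma>_ne in simp)
      have alg: "z / complex_of_real c * y + (- 1 / complex_of_real c) * (z * y + (- complex_of_real c) * v) = v"
        for z y v :: complex
        using c_ne by (simp add: field_simps)
      have "w ?h = ?u"
        unfolding w_def \<phi> alg ..
      then have "R (w ?h) = R ?u"
        by (rule arg_cong)
      also have "R ?u = f"
        using Ru by (rule ext)
      finally have "R (w ?h) = f" .
      then show ?thesis
        unfolding T[OF f] .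
    qed
    show "H2 \<kappa> a (R (w h)) x - complex_of_real (2 * \<kappa> * s) * R (w h) x = h x" if h: "h \<in> l2" for h x
    proof -
      have "R h 0 = \<phi> h * complex_of_real (green a s 0 - c)"
        using \<Gamma>_ne by (simp add: \<phi>_def)
      then have R0: "R (w h) 0 = \<phi> h"
        unfolding w_def[abs_def] R_lin[OF d(1) h] using c_ne by (simp add: Rd field_simps)
      have "(1 + s) *\<^sub>R R (w h) x - conv a (R (w h)) x = w h x"
        unfolding R_def by (rule green_right_inverse[OF s cmod_le_l2_norm[OF w[OF h]]])
      then have "H2 \<kappa> a (R (w h)) x - complex_of_real (2 * \<kappa> * s) * R (w h) x =
          \<phi> h * d x + (- complex_of_real c) * w h x"
        unfolding T[OF R(1)[OF w[OF h]]] by (simp add: R0)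
      then show ?thesis
        using c_ne by (simp add: w_def field_simps)
    qed
    define K where "K = 2 * (1 / s / \<bar>green a s 0 - c\<bar> / c)\<^sup>2 + 2 * (1 / c)\<^sup>2"
    show "l2_norm (R (w h)) \<le> 1 / s * sqrt K * l2_norm h" if h: "h \<in> l2" for h
    proof -
      have "cmod (R h 0) \<le> 1 / s * l2_norm h"
        using cmod_le_l2_norm[OF R(1)[OF h]] R(2)[OF h] order_trans by blast
      then have "cmod (\<phi> h) \<le> 1 / s * l2_norm h / \<bar>green a s 0 - c\<bar>"
        unfolding \<phi>_def norm_divide norm_of_real by (rule divide_right_mono) simp
      then have "cmod (\<phi> h) / c \<le> 1 / s * l2_norm h / \<bar>green a s 0 - c\<bar> / c"
        using c by (intro divide_right_mono) auto
      then have "(cmod (\<phi> h) / c)\<^sup>2 \<le> (1 / s * l2_norm h / \<bar>green a s 0 - c\<bar> / c)\<^sup>2"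
        using c by (intro power_mono) auto
      then have \<phi>: "(cmod (\<phi> h) / c)\<^sup>2 \<le> (1 / s / \<bar>green a s 0 - c\<bar> / c)\<^sup>2 * (l2_norm h)\<^sup>2"
        by (simp add: power_mult_distrib power_divide)
      have "(l2_norm (w h))\<^sup>2 \<le> 2 * (l2_norm (\<lambda>x. \<phi> h / complex_of_real c * d x))\<^sup>2 +
          2 * (l2_norm (\<lambda>x. (- 1 / complex_of_real c) * h x))\<^sup>2"
        unfolding w_def[abs_def] by (intro l2_add(2) l2_cmult(1) d(1) h)
      also have "\<dots> = 2 * (cmod (\<phi> h) / c)\<^sup>2 + 2 * (1 / c)\<^sup>2 * (l2_norm h)\<^sup>2"
        unfolding l2_cmult(2)[OF d(1)] l2_cmult(2)[OF h] power_mult_distrib d(2)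
        using c by (simp add: norm_divide)
      also have "\<dots> \<le> K * (l2_norm h)\<^sup>2"
        using \<phi> by (simp add: K_def algebra_simps)
      finally have "(l2_norm (w h))\<^sup>2 \<le> (sqrt K * l2_norm h)\<^sup>2"
        by (simp add: power_mult_distrib K_def)
      then have "l2_norm (w h) \<le> sqrt K * l2_norm h"
        by (rule power2_le_imp_le) (simp add: K_def l2_norm_nonneg)
      then have "1 / s * l2_norm (w h) \<le> 1 / s * (sqrt K * l2_norm h)"
        using s by (intro mult_left_mono) auto
      then show ?thesis
        using R(2)[OF w[OF h]] by simp
    qed
  qed
qed

text \<open>The eigenfunction is \<open>g\<^sub>s\<close>.\<close>

lemma eigenvalue_in_spectrum_H2:
  fixes a :: "int ^ 'd \<Rightarrow> real"
  assumes a: "walk_kernel a" and \<kappa>: "\<kappa> > 0" and s: "s > 0" and eq: "green a s 0 = 2 * \<kappa>"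
  shows "complex_of_real (2 * \<kappa> * s) \<in> spectrum (H2 \<kappa> a)"
proof (rule ccontr)
  interpret prob_kernel a using a by (rule walk_kernel_prob_kernel)
  assume "complex_of_real (2 * \<kappa> * s) \<notin> spectrum (H2 \<kappa> a)"
  then have "complex_of_real (2 * \<kappa> * s) \<in> resolvent_set (H2 \<kappa> a)"
    by (simp add: spectrum_def)
  then obtain C where C: "\<And>f. f \<in> l2 \<Longrightarrow>
      l2_norm f \<le> C * l2_norm (\<lambda>x. H2 \<kappa> a f x - complex_of_real (2 * \<kappa> * s) * f x)"
    using resolvent_set_bounded_below by blast
  define d :: "int ^ 'd \<Rightarrow> complex" where "d x = complex_of_real (indicator {0} x)" for x
  define f where "f = conv (green a s) d"
  have hs: "(green a s has_sum (1 / s)) UNIV"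
    using green_summable[OF s] green_infsum[OF s] by (simp add: has_sum_iff)
  have d: "d \<in> l2"
    unfolding d_def[abs_def] by (rule l2_indicator) simp
  have f: "f \<in> l2"
    unfolding f_def using s by (intro l2_conv[OF hs green_nonneg[OF s] _ d]) simp
  have f_eq: "f x = complex_of_real (green a s x)" for x
    unfolding f_def d_def[abs_def] by (rule conv_indicator_complex)
  have "(1 + s) *\<^sub>R f x - conv a f x = d x" for x
    unfolding f_def by (rule green_right_inverse[OF s cmod_le_l2_norm[OF d]])
  then have "H2 \<kappa> a f x - complex_of_real (2 * \<kappa> * s) * f x = 0" for x
    unfolding H2_shifted_eq[OF a f \<kappa>] using eq by (simp add: f_eq d_def delta0_def indicator_def)
  then have "l2_norm f \<le> 0"
    using C[OF f] by (simp add: l2_norm_def)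
  then have "cmod (f 0) \<le> 0"
    using cmod_le_l2_norm[OF f, of 0] by linarith
  then show False
    using green_0_pos[OF s] by (simp add: f_eq)
qed

section \<open>Almost invariant boxes: zero is in the spectrum\<close>

text \<open>The cube centred at the origin with \<open>2n + 1\<close> lattice points on a side.\<close>

definition lattice_box :: "nat \<Rightarrow> (int ^ 'd) set" where
  "lattice_box n = {x. \<forall>i. x $ i \<in> {- int n..int n}}"

lemma lattice_box_finite_card: "finite (lattice_box n :: (int ^ 'd) set)" "card (lattice_box n :: (int ^ 'd) set) = (2 * n + 1) ^ CARD('d)"
proof -
  have bij: "bij_betw vec_nth (lattice_box n :: (int ^ 'd) set) (Pi\<^sub>E UNIV (\<lambda>_. {- int n..int n}))"
    by (rule bij_betw_byWitness[where f' = vec_lambda]) (auto simp: lattice_box_def PiE_iff)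
  show "finite (lattice_box n :: (int ^ 'd) set)"
    unfolding bij_betw_finite[OF bij] by (intro finite_PiE) auto
  show "card (lattice_box n :: (int ^ 'd) set) = (2 * n + 1) ^ CARD('d)"
    unfolding bij_betw_same_card[OF bij] by (simp add: card_PiE nat_add_distrib nat_mult_distrib)
qed

lemma finite_subset_lattice_box:
  fixes F :: "(int ^ 'd) set"
  assumes "finite F"
  obtains m where "F \<subseteq> lattice_box m"
proof -
  define S where "S = (\<lambda>(x, i). nat \<bar>x $ i\<bar>) ` (F \<times> UNIV)"
  have S: "finite S" unfolding S_def using assms by simp
  have "x $ i \<in> {- int (Max S)..int (Max S)}" if "x \<in> F" for x i
  proof -
    have "nat \<bar>x $ i\<bar> \<in> S" unfolding S_def using that by force
    from Max_ge[OF S this] show ?thesis by auto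
  qed
  then have "F \<subseteq> lattice_box (Max S)" by (auto simp: lattice_box_def)
  then show ?thesis by (rule that)
qed

lemma lattice_box_diff_mem:
  assumes "x - z \<in> lattice_box n" "z \<in> lattice_box m"
  shows "x \<in> lattice_box (n + m)"
proof -
  have "x $ i \<in> {- int (n + m)..int (n + m)}" for i
  proof -
    have "- int n \<le> x $ i - z $ i" "x $ i - z $ i \<le> int n" "- int m \<le> z $ i" "z $ i \<le> int m"
      using assms by (auto simp: lattice_box_def)
    then show ?thesis by simp
  qed
  then show ?thesis by (simp add: lattice_box_def)
qed

text \<open>Boxes form a Foelner sequence: their volume grows polynomially, so enlarging a box by a fixed width
  changes it by an arbitrarily small proportion.\<close>

lemma lattice_box_card_ratio:
  assumes "e > 0"
  shows "eventually (\<lambda>n. real (card (lattice_box (n + m) :: (int ^ 'd) set)) \<le> (1 + e) * real (card (lattice_box n :: (int ^ 'd) set)))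
    sequentially"
proof -
  have "(\<lambda>n. ((2 * real n + 2 * real m + 1) / (2 * real n + 1)) ^ CARD('d)) \<longlonglongrightarrow> 1 ^ CARD('d)"
    by (intro tendsto_power) real_asymp
  then have "eventually (\<lambda>n. ((2 * real n + 2 * real m + 1) / (2 * real n + 1)) ^ CARD('d) < 1 + e) sequentially"
    using assms by (intro order_tendstoD) auto
  then show ?thesis
  proof eventually_elim
    case (elim n)
    have "(2 * real n + 2 * real m + 1) ^ CARD('d) \<le> (1 + e) * (2 * real n + 1) ^ CARD('d)"
      using elim by (simp add: power_divide pos_divide_less_eq)
    then show ?case
      by (simp add: lattice_box_finite_card algebra_simps)
  qed
qed

text \<open>For an indicator \<open>f\<close> the function \<open>a * f - f\<close> takes values of modulus at most 1, so its square is
  bounded by its modulus. Here \<open>D z\<close> is the size of the symmetric difference of \<open>B\<close> and \<open>B + z\<close>.\<close>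

lemma (in prob_kernel) conv_indicator_energy:
  fixes B :: "'g set"
  assumes B: "finite B"
    and D: "\<And>z. D z \<le> 2 * real (card B)"
      "\<And>z. ((\<lambda>x. \<bar>indicator B (x - z) - indicator B x\<bar>) has_sum D z) UNIV"
  defines "f \<equiv> \<lambda>x. complex_of_real (indicator B x)"
  shows "(\<Sum>\<^sub>\<infinity>x. (cmod (conv a f x - f x))\<^sup>2) \<le> (\<Sum>\<^sub>\<infinity>z. a z * D z)"
proof -
  let ?d = "\<lambda>z x. \<bar>indicator B (x - z) - indicator B x\<bar> :: real"
  have d1: "?d z x \<le> 1" for z x by (auto simp: indicator_def)
  have D0: "0 \<le> D z" for z by (rule has_sum_nonneg[OF D(2)]) simp
  have aD: "(\<lambda>z. a z * D z) summable_on UNIV"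
    by (rule summable_on_comparison_test[where f = "\<lambda>z. a z * (2 * real (card B))"])
      (auto intro!: summable_on_cmult_left summable mult_left_mono D(1) mult_nonneg_nonneg nonneg D0)
  have "(\<lambda>(z, x). a z * ?d z x) abs_summable_on UNIV \<times> UNIV"
  proof (rule Infinite_Sum.abs_summable_on_Sigma_iff[THEN iffD2], intro conjI ballI)
    show "(\<lambda>x. case (z, x) of (z, x) \<Rightarrow> a z * ?d z x) abs_summable_on UNIV" for z
      using has_sum_imp_summable[OF D(2)[of z]] by (simp add: abs_mult summable_on_cmult_right)
    show "(\<lambda>z. \<Sum>\<^sub>\<infinity>x. norm (case (z, x) of (z, x) \<Rightarrow> a z * ?d z x)) abs_summable_on UNIV"
      using aD by (simp add: abs_mult infsum_cmult_right' infsumI[OF D(2)] nonneg D0)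
  qed
  then have sm: "(\<lambda>(z, x). a z * ?d z x) summable_on UNIV \<times> UNIV"
    by (rule abs_summable_summable)
  then have "(\<lambda>(x, z). a z * ?d z x) summable_on UNIV \<times> UNIV"
    by (subst (asm) summable_on_swap) simp
  then have sm': "(\<lambda>x. \<Sum>\<^sub>\<infinity>z. a z * ?d z x) summable_on UNIV"
    by (rule summable_on_Sigma_banach)
  have le: "(cmod (conv a f x - f x))\<^sup>2 \<le> (\<Sum>\<^sub>\<infinity>z. a z * ?d z x)" for x
  proof -
    have s1: "(\<lambda>z. a z * ?d z x) summable_on UNIV"
      by (rule summable_on_comparison_test[OF summable])
        (auto intro!: mult_left_le d1 nonneg mult_nonneg_nonneg)
    have cm: "norm (a z *\<^sub>R (f (x - z) - f x)) = a z * ?d z x" for z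
      unfolding f_def of_real_diff[symmetric] norm_scaleR norm_of_real by (simp add: nonneg)
    have f1: "norm (f x) \<le> 1" for x by (simp add: f_def indicator_def)
    have s2: "(\<lambda>z. a z *\<^sub>R (f (x - z) - f x)) abs_summable_on UNIV"
      unfolding cm by (rule s1)
    have "conv a f x - f x = (\<Sum>\<^sub>\<infinity>z. a z *\<^sub>R f (x - z)) + (\<Sum>\<^sub>\<infinity>z. - (a z *\<^sub>R f x))"
      by (simp add: conv_def infsum_uminus infsum_scaleR_left summable infsum_eq_1)
    also have "\<dots> = (\<Sum>\<^sub>\<infinity>z. a z *\<^sub>R (f (x - z) - f x))"
      by (subst infsum_add[symmetric])
        (auto intro!: conv_summable_on[OF summable f1] summable_on_scaleR_left summable
          simp: scaleR_right_diff_distrib summable_on_uminus)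
    finally have "cmod (conv a f x - f x) \<le> (\<Sum>\<^sub>\<infinity>z. a z * ?d z x)"
      using norm_infsum_bound[OF s2] by (simp only: cm)
    moreover have "(\<Sum>\<^sub>\<infinity>z. a z * ?d z x) \<le> 1"
      unfolding infsum_eq_1[symmetric]
      by (intro infsum_mono s1 summable mult_left_le d1 nonneg)
    ultimately have "cmod (conv a f x - f x) * cmod (conv a f x - f x) \<le> (\<Sum>\<^sub>\<infinity>z. a z * ?d z x) * 1"
      by (intro mult_mono) (auto intro!: infsum_nonneg mult_nonneg_nonneg nonneg)
    then show ?thesis by (simp add: power2_eq_square)
  qed
  have "(\<Sum>\<^sub>\<infinity>x. (cmod (conv a f x - f x))\<^sup>2) \<le> (\<Sum>\<^sub>\<infinity>x. \<Sum>\<^sub>\<infinity>z. a z * ?d z x)"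
    by (intro infsum_mono sm' le summable_on_comparison_test[OF sm']) auto
  also have "\<dots> = (\<Sum>\<^sub>\<infinity>z. \<Sum>\<^sub>\<infinity>x. a z * ?d z x)"
    by (rule infsum_swap_banach[OF sm, symmetric])
  also have "\<dots> = (\<Sum>\<^sub>\<infinity>z. a z * D z)"
    by (simp add: infsum_cmult_right' infsumI[OF D(2)])
  finally show ?thesis .
qed

lemma indicator_has_sum:
  fixes B :: "'g::ab_group_add set"
  assumes "finite B"
  shows "((\<lambda>x. indicator B (x - z)) has_sum real (card B)) UNIV"
proof -
  have "((\<lambda>x. 1) has_sum real (card B)) B"
    using assms by (intro has_sum_finiteI) auto
  then have "(indicator B has_sum real (card B)) UNIV"
    by (rule has_sum_cong_neutral[THEN iffD1, rotated -1]) auto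
  then show ?thesis
    by (subst has_sum_reindex_bij_betw[OF bij_diff_right])
qed

text \<open>For \<open>z\<close> in a fixed box \<open>lattice_box m\<close> that carries almost all the mass of \<open>a\<close>, the box and its translate
  by \<open>z\<close> both lie in \<open>lattice_box (n + m)\<close>, which is barely larger; the remaining \<open>z\<close> contribute
  little.\<close>

lemma almost_invariant_boxes:
  fixes a :: "int ^ 'd \<Rightarrow> real"
  assumes "prob_kernel a" and e: "e > 0"
  shows "eventually (\<lambda>n. (\<Sum>\<^sub>\<infinity>x. (cmod (conv a (\<lambda>x. complex_of_real (indicator (lattice_box n) x)) x -
      complex_of_real (indicator (lattice_box n) x)))\<^sup>2) \<le> e * real (card (lattice_box n :: (int ^ 'd) set))) sequentially"
proof -
  interpret prob_kernel a by fact
  obtain F where F: "finite F" "norm (sum a F - 1) \<le> e / 4"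
    using has_sum_finite_approximation[OF total, of "e / 4"] e by (auto simp: dist_norm)
  obtain m where m: "F \<subseteq> lattice_box m" by (rule finite_subset_lattice_box[OF F(1)])
  define b where "b n = real (card (lattice_box n :: (int ^ 'd) set))" for n
  define t where "t z = (if z \<in> lattice_box m then 0 else a z)" for z
  have tail: "(t has_sum (1 - sum a (lattice_box m))) UNIV"
  proof -
    have "((\<lambda>z. if z \<in> lattice_box m then a z else 0) has_sum sum a (lattice_box m)) UNIV"
      by (rule has_sum_cong_neutral[THEN iffD1, OF _ _ _ has_sum_finite[of "lattice_box m" a]])
        (auto simp: lattice_box_finite_card)
    then have "((\<lambda>z. a z + - (if z \<in> lattice_box m then a z else 0)) has_sum (1 + - sum a (lattice_box m))) UNIV"
      by (intro has_sum_add total has_sum_uminusI)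
    also have "(\<lambda>z. a z + - (if z \<in> lattice_box m then a z else 0)) = t"
      by (auto simp: t_def)
    finally show ?thesis by simp
  qed
  have "sum a F \<le> sum a (lattice_box m)"
    using m nonneg by (intro sum_mono2 lattice_box_finite_card) auto
  then have tail_le: "1 - sum a (lattice_box m) \<le> e / 4"
    using F(2) unfolding real_norm_def by linarith
  have "eventually (\<lambda>n. b (n + m) \<le> (1 + e / 4) * b n) sequentially"
    unfolding b_def using e by (intro lattice_box_card_ratio) simp
  then show ?thesis
  proof eventually_elim
    case (elim n)
    let ?B = "lattice_box n :: (int ^ 'd) set"
    let ?d = "\<lambda>z x. \<bar>indicator ?B (x - z) - indicator ?B x\<bar> :: real"
    have bs: "((\<lambda>x. indicator (lattice_box k) (x - z)) has_sum b k) UNIV" for k and z :: "int ^ 'd"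
      unfolding b_def by (rule indicator_has_sum[OF lattice_box_finite_card(1)])
    note bs0 = bs[of _ 0, simplified]
    define D where "D z = (\<Sum>\<^sub>\<infinity>x. ?d z x)" for z
    \<comment> \<open>the union bound for the symmetric difference, valid for all \<open>z\<close>\<close>
    have sum1: "((\<lambda>x. indicator ?B (x - z) + indicator ?B x) has_sum (b n + b n)) UNIV" for z
      by (intro has_sum_add bs bs0)
    have D: "(?d z has_sum D z) UNIV" for z
      unfolding D_def
      by (rule has_sum_infsum, rule summable_on_comparison_test[OF has_sum_imp_summable[OF sum1[of z]]])
        (auto simp: indicator_def)
    have D2: "D z \<le> 2 * b n" for z
      using has_sum_mono[OF D[of z] sum1[of z]] by (auto simp: indicator_def)
    have Dm: "D z \<le> 2 * b (n + m) - 2 * b n" if "z \<in> lattice_box m" for z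
    proof -
      have "((\<lambda>x. 2 * indicator (lattice_box (n + m)) x + - (indicator ?B (x - z) + indicator ?B x)) has_sum
          (2 * b (n + m) + - (b n + b n))) UNIV"
        by (intro has_sum_add[OF has_sum_cmult_right has_sum_uminusI] bs0 sum1)
      moreover have "?d z x \<le> 2 * indicator (lattice_box (n + m)) x + - (indicator ?B (x - z) + indicator ?B x)" for x
      proof -
        have "x - z \<in> ?B \<Longrightarrow> x \<in> lattice_box (n + m)"
          using lattice_box_diff_mem that by blast
        moreover have "x \<in> ?B \<Longrightarrow> x \<in> lattice_box (n + m)"
          using lattice_box_diff_mem[of x 0 n m] by (simp add: lattice_box_def)
        ultimately show ?thesis
          by (auto simp: indicator_def)
      qed
      ultimately have "D z \<le> 2 * b (n + m) + - (b n + b n)"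
        by (rule has_sum_mono[OF D[of z]])
      then show ?thesis by simp
    qed
    have "(\<Sum>\<^sub>\<infinity>x. (cmod (conv a (\<lambda>x. complex_of_real (indicator ?B x)) x - complex_of_real (indicator ?B x)))\<^sup>2)
        \<le> (\<Sum>\<^sub>\<infinity>z. a z * D z)"
      by (rule conv_indicator_energy) (use D D2 in \<open>auto simp: b_def lattice_box_finite_card(1)\<close>)
    also have "\<dots> \<le> 1 * (2 * b (n + m) - 2 * b n) + (1 - sum a (lattice_box m)) * (2 * b n)"
    proof (rule has_sum_mono[OF has_sum_infsum])
      show "(\<lambda>z. a z * D z) summable_on UNIV"
        by (rule summable_on_comparison_test[where f = "\<lambda>z. a z * (2 * b n)"])
          (auto intro!: summable_on_cmult_left summable mult_left_mono D2 mult_nonneg_nonneg nonneg has_sum_nonneg[OF D])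
      show "((\<lambda>z. a z * (2 * b (n + m) - 2 * b n) + t z * (2 * b n)) has_sum
          1 * (2 * b (n + m) - 2 * b n) + (1 - sum a (lattice_box m)) * (2 * b n)) UNIV"
        by (intro has_sum_add has_sum_cmult_left total tail)
      have "D 0 = 0" by (simp add: D_def)
      have nn: "0 \<le> 2 * b (n + m) - 2 * b n"
        using Dm[of 0] \<open>D 0 = 0\<close> by (simp add: lattice_box_def)
      show "a z * D z \<le> a z * (2 * b (n + m) - 2 * b n) + t z * (2 * b n)" for z
      proof (cases "z \<in> lattice_box m")
        case True
        then show ?thesis
          using mult_left_mono[OF Dm[OF True] nonneg] by (simp add: t_def)
      next
        case False
        then show ?thesis
          using mult_left_mono[OF D2[of z] nonneg[of z]] mult_nonneg_nonneg[OF nonneg[of z] nn]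
          by (simp add: t_def)
      qed
    qed
    also have "\<dots> \<le> 2 * (e / 4 * b n) + e / 4 * (2 * b n)"
    proof -
      have "b n \<ge> 0" by (simp add: b_def)
      then have "(1 - sum a (lattice_box m)) * (2 * b n) \<le> e / 4 * (2 * b n)"
        using tail_le by (intro mult_right_mono) auto
      then show ?thesis using elim by (simp add: algebra_simps)
    qed
    also have "\<dots> = e * b n" by simp
    finally show ?case by (simp add: b_def)
  qed
qed

text \<open>On a large box the perturbation contributes at most 1 to a squared norm that tends to infinity.\<close>

lemma zero_in_spectrum_H2:
  fixes a :: "int ^ 'd \<Rightarrow> real"
  assumes a: "walk_kernel a" and \<kappa>: "\<kappa> > 0"
  shows "0 \<in> spectrum (H2 \<kappa> a)"
proof (rule ccontr)
  interpret prob_kernel a using a by (rule walk_kernel_prob_kernel)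
  assume "0 \<notin> spectrum (H2 \<kappa> a)"
  then have "0 \<in> resolvent_set (H2 \<kappa> a)"
    by (simp add: spectrum_def)
  then obtain C where C: "\<And>f. f \<in> l2 \<Longrightarrow> l2_norm f \<le> C * l2_norm (H2 \<kappa> a f)"
    using resolvent_set_bounded_below[of 0 "H2 \<kappa> a"] by auto
  define c where "c = 2 * \<kappa>"
  \<comment> \<open>chosen so that \<open>\<parallel>f\<parallel>\<^sup>2 \<le> C\<^sup>2 \<parallel>H\<^sub>2 f\<parallel>\<^sup>2\<close> becomes \<open>b \<le> b/4 + 2C\<^sup>2\<close>, where \<open>b = \<parallel>f\<parallel>\<^sup>2\<close>\<close>
  define e where "e = 1 / (8 * c\<^sup>2 * (C\<^sup>2 + 1))"
  have c: "c > 0" using \<kappa> by (simp add: c_def)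
  have C1: "C\<^sup>2 + 1 > 0" by (simp add: add_nonneg_pos)
  have e: "e > 0" unfolding e_def using c C1 by (intro divide_pos_pos mult_pos_pos) auto
  have "eventually (\<lambda>n. real n > 8 * C\<^sup>2) sequentially"
    using filterlim_real_sequentially by (simp add: filterlim_at_top_dense)
  with almost_invariant_boxes[OF prob_kernel_axioms e]
  have "eventually (\<lambda>n. (\<Sum>\<^sub>\<infinity>x. (cmod (conv a (\<lambda>x. complex_of_real (indicator (lattice_box n) x)) x -
      complex_of_real (indicator (lattice_box n) x)))\<^sup>2) \<le> e * real (card (lattice_box n :: (int ^ 'd) set)) \<and>
      real n > 8 * C\<^sup>2) sequentially"
    by (rule eventually_conj)
  then obtain n where n: "real n > 8 * C\<^sup>2" and
    energy: "(\<Sum>\<^sub>\<infinity>x. (cmod (conv a (\<lambda>x. complex_of_real (indicator (lattice_box n) x)) x -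
      complex_of_real (indicator (lattice_box n) x)))\<^sup>2) \<le> e * real (card (lattice_box n :: (int ^ 'd) set))"
    unfolding eventually_sequentially by blast
  define b where "b = real (card (lattice_box n :: (int ^ 'd) set))"
  define f where "f x = complex_of_real (indicator (lattice_box n) x)" for x :: "int ^ 'd"
  have b: "b > 8 * C\<^sup>2"
  proof -
    have "2 * n + 1 \<le> (2 * n + 1) ^ CARD('d)"
      by (rule self_le_power) auto
    then have "real (2 * n + 1) \<le> b"
      unfolding b_def lattice_box_finite_card(2) of_nat_le_iff .
    then show ?thesis using n by simp
  qed
  have f: "f \<in> l2" "(l2_norm f)\<^sup>2 = b"
    unfolding f_def[abs_def] b_def by (rule l2_indicator[OF lattice_box_finite_card(1)])+
  define Af where "Af x = conv a f x + (-1) * f x" for x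
  have Af: "Af \<in> l2" "(l2_norm Af)\<^sup>2 \<le> e * b"
  proof -
    show "Af \<in> l2"
      unfolding Af_def[abs_def] by (intro l2_add l2_cmult f(1) l2_conv[OF total nonneg]) simp
    show "(l2_norm Af)\<^sup>2 \<le> e * b"
      using energy by (simp add: l2_norm_power2 Af_def f_def[abs_def] b_def)
  qed
  have H: "H2 \<kappa> a f = (\<lambda>x. complex_of_real c * Af x + complex_of_real (delta0 x) * f x)"
    by (rule ext) (simp add: H2_def op_A_eq_conv[OF a cmod_le_l2_norm[OF f(1)]] Af_def c_def scaleR_conv_of_real)
  have f0: "(cmod (f 0))\<^sup>2 \<le> 1" by (simp add: f_def indicator_def)
  have "(l2_norm (H2 \<kappa> a f))\<^sup>2 \<le> 2 * (l2_norm (\<lambda>x. complex_of_real c * Af x))\<^sup>2 + 2 * (cmod (f 0))\<^sup>2"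
    unfolding H l2_delta0(2)[OF f(1), symmetric] by (intro l2_add(2) l2_cmult(1) Af(1) l2_delta0 f(1))
  also have "\<dots> = 2 * c\<^sup>2 * (l2_norm Af)\<^sup>2 + 2 * (cmod (f 0))\<^sup>2"
    using c by (simp add: l2_cmult(2)[OF Af(1)] power_mult_distrib)
  also have "\<dots> \<le> 2 * c\<^sup>2 * (e * b) + 2 * 1"
    using Af(2) f0 by (intro add_mono mult_left_mono) auto
  finally have Hf: "(l2_norm (H2 \<kappa> a f))\<^sup>2 \<le> 2 * c\<^sup>2 * (e * b) + 2" by simp
  have "b \<le> (C * l2_norm (H2 \<kappa> a f))\<^sup>2"
    unfolding f(2)[symmetric] using C[OF f(1)] l2_norm_nonneg by (intro power_mono) auto
  also have "\<dots> \<le> C\<^sup>2 * (2 * c\<^sup>2 * (e * b) + 2)"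
    unfolding power_mult_distrib using Hf by (intro mult_left_mono) auto
  also have "\<dots> \<le> (C\<^sup>2 + 1) * (2 * c\<^sup>2 * (e * b)) + 2 * C\<^sup>2"
  proof -
    have "0 \<le> 2 * c\<^sup>2 * (e * b)" using e by (simp add: b_def)
    then show ?thesis by (simp add: algebra_simps)
  qed
  also have "(C\<^sup>2 + 1) * (2 * c\<^sup>2 * (e * b)) = b / 4"
  proof -
    have "8 * c\<^sup>2 * (C\<^sup>2 + 1) * e = 1"
      unfolding e_def using c C1 by simp
    then have "(8 * c\<^sup>2 * (C\<^sup>2 + 1) * e) * b = b" by simp
    then show ?thesis by (simp add: algebra_simps)
  qed
  finally have "b \<le> b / 4 + 2 * C\<^sup>2" .
  moreover have "0 \<le> C\<^sup>2" by simp
  ultimately show False using b by linarith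
qed

section \<open>The top of the spectrum\<close>

text \<open>The eigenvalue is found by the intermediate value theorem, since \<open>\<Gamma>(s) \<le> 1/s\<close>. It is the maximum
  of the spectrum because \<open>\<Gamma>\<close> is strictly decreasing.\<close>

lemma lambda0_pos:
  fixes a :: "int ^ 'd \<Rightarrow> real"
  assumes a: "walk_kernel a" and \<kappa>: "\<kappa> > 0" and r: "r > 0" "green a r 0 > 2 * \<kappa>"
  shows "lambda0 (H2 \<kappa> a) > 0"
proof -
  interpret prob_kernel a using a by (rule walk_kernel_prob_kernel)
  define q where "q = max r (1 / (2 * \<kappa>))"
  have q: "q > 0" "r \<le> q" "1 / (2 * \<kappa>) \<le> q" using r by (auto simp: q_def)
  have "green a q 0 \<le> 1 / q"
    by (rule green_le[OF q(1)])
  also have "\<dots> \<le> 2 * \<kappa>"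
    using q \<kappa> by (simp add: field_simps)
  finally have "green a q 0 \<le> 2 * \<kappa>" .
  moreover have "continuous_on {r..q} (\<lambda>s. green a s 0)"
    by (rule continuous_on_subset[OF green_0_continuous]) (use r in auto)
  ultimately obtain s where s: "r \<le> s" "green a s 0 = 2 * \<kappa>"
    using IVT2'[of "\<lambda>s. green a s 0" q "2 * \<kappa>" r] r q by auto
  have s0: "s > 0" using r s by simp
  have "lambda0 (H2 \<kappa> a) = 2 * \<kappa> * s"
    unfolding lambda0_def
  proof (rule Greatest_equality)
    show "complex_of_real (2 * \<kappa> * s) \<in> spectrum (H2 \<kappa> a)"
      by (rule eigenvalue_in_spectrum_H2[OF a \<kappa> s0 s(2)])
    fix y assume y: "complex_of_real y \<in> spectrum (H2 \<kappa> a)"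
    show "y \<le> 2 * \<kappa> * s"
    proof (rule ccontr)
      assume "\<not> y \<le> 2 * \<kappa> * s"
      then have lt: "s < y / (2 * \<kappa>)" using \<kappa> by (simp add: field_simps)
      have "green a (y / (2 * \<kappa>)) 0 < 2 * \<kappa>"
        using green_0_decreasing[OF s0 lt] s(2) by simp
      then have "complex_of_real (2 * \<kappa> * (y / (2 * \<kappa>))) \<in> resolvent_set (H2 \<kappa> a)"
        using lt s0 by (intro in_resolvent_set_H2[OF a \<kappa>]) auto
      then show False
        using y \<kappa> by (simp add: spectrum_def)
    qed
  qed
  then show ?thesis using \<kappa> s0 by simp
qed

lemma lambda0_eq_0:
  fixes a :: "int ^ 'd \<Rightarrow> real"
  assumes a: "walk_kernel a" and \<kappa>: "\<kappa> > 0" and lt: "\<And>s. s > 0 \<Longrightarrow> green a s 0 < 2 * \<kappa>"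
  shows "lambda0 (H2 \<kappa> a) = 0"
  unfolding lambda0_def
proof (rule Greatest_equality)
  show "complex_of_real 0 \<in> spectrum (H2 \<kappa> a)"
    using zero_in_spectrum_H2[OF a \<kappa>] by simp
  fix y assume y: "complex_of_real y \<in> spectrum (H2 \<kappa> a)"
  show "y \<le> 0"
  proof (rule ccontr)
    assume "\<not> y \<le> 0"
    then have "y / (2 * \<kappa>) > 0" using \<kappa> by simp
    from in_resolvent_set_H2[OF a \<kappa> this] lt[OF this]
    have "complex_of_real (2 * \<kappa> * (y / (2 * \<kappa>))) \<in> resolvent_set (H2 \<kappa> a)"
      by simp
    then show False
      using y \<kappa> by (simp add: spectrum_def)
  qed
qed

lemma lambda0_pos_iff_green_unbounded:
  fixes a :: "int ^ 'd \<Rightarrow> real"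
  assumes a: "walk_kernel a"
  shows "(\<forall>\<kappa>>0. lambda0 (H2 \<kappa> a) > 0) \<longleftrightarrow> (\<forall>M. \<exists>s>0. green a s 0 > M)"
proof
  assume pos: "\<forall>\<kappa>>0. lambda0 (H2 \<kappa> a) > 0"
  show "\<forall>M. \<exists>s>0. green a s 0 > M"
  proof (rule ccontr)
    assume "\<not> (\<forall>M. \<exists>s>0. green a s 0 > M)"
    then obtain M where "\<not> (\<exists>s>0. green a s 0 > M)" by blast
    then have M: "green a s 0 \<le> M" if "s > 0" for s
      using that by (meson not_le)
    define \<kappa> where "\<kappa> = \<bar>M\<bar> + 1"
    have "\<kappa> > 0" by (simp add: \<kappa>_def)
    moreover have "green a s 0 < 2 * \<kappa>" if "s > 0" for s
      using M[OF that] by (simp add: \<kappa>_def)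
    ultimately have "lambda0 (H2 \<kappa> a) = 0"
      by (rule lambda0_eq_0[OF a])
    then show False
      using pos \<open>\<kappa> > 0\<close> by force
  qed
next
  assume "\<forall>M. \<exists>s>0. green a s 0 > M"
  then show "\<forall>\<kappa>>0. lambda0 (H2 \<kappa> a) > 0"
    using lambda0_pos[OF a] by meson
qed

section \<open>The torus integral\<close>

lemma lattice_vec_0: "lattice_vec 0 = 0"
  by (simp add: lattice_vec_def vec_eq_iff)

lemma lattice_vec_diff: "lattice_vec (x - y) = lattice_vec x - lattice_vec y"
  by (simp add: lattice_vec_def vec_eq_iff)

lemma lattice_vec_minus: "lattice_vec (- x) = - lattice_vec x"
  by (simp add: lattice_vec_def vec_eq_iff)

text \<open>The Fourier series with coefficients \<open>u\<close>. It is the eigenvalue of convolution with \<open>u\<close> at the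
  character \<open>x \<mapsto> e\<^sup>-\<^sup>i\<^sup>k\<^sup>x\<close> (\<open>conv_character\<close>), so the algebra of convolutions carries over to it.\<close>

definition fourier :: "(int ^ 'd \<Rightarrow> real) \<Rightarrow> real ^ 'd \<Rightarrow> complex" where
  "fourier u k = (\<Sum>\<^sub>\<infinity>x. u x *\<^sub>R cis (k \<bullet> lattice_vec x))"

lemma conv_character:
  "conv u (\<lambda>x. cis (- (k \<bullet> lattice_vec x))) x = fourier u k * cis (- (k \<bullet> lattice_vec x))"
proof -
  have "conv u (\<lambda>x. cis (- (k \<bullet> lattice_vec x))) x =
      (\<Sum>\<^sub>\<infinity>y. (u y *\<^sub>R cis (k \<bullet> lattice_vec y)) * cis (- (k \<bullet> lattice_vec x)))"
    unfolding conv_def by (simp add: lattice_vec_diff inner_diff_right cis_mult)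
  also have "\<dots> = fourier u k * cis (- (k \<bullet> lattice_vec x))"
    unfolding fourier_def by (rule infsum_cmult_left')
  finally show ?thesis .
qed

lemma fourier_eq_conv: "fourier u k = conv u (\<lambda>x. cis (- (k \<bullet> lattice_vec x))) 0"
  by (simp add: conv_character lattice_vec_0)

lemma fourier_conv:
  assumes "u summable_on UNIV" "v summable_on UNIV"
  shows "fourier (conv u v) k = fourier u k * fourier v k"
proof -
  have "fourier (conv u v) k = conv u (conv v (\<lambda>x. cis (- (k \<bullet> lattice_vec x)))) 0"
    unfolding fourier_eq_conv by (rule conv_assoc[symmetric, where M = 1]) (use assms in auto)
  also have "conv v (\<lambda>x. cis (- (k \<bullet> lattice_vec x))) =
      (\<lambda>x. fourier v k * cis (- (k \<bullet> lattice_vec x)))"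
    by (rule ext) (rule conv_character)
  also have "conv u (\<lambda>x. fourier v k * cis (- (k \<bullet> lattice_vec x))) 0 = fourier v k * fourier u k"
    unfolding fourier_eq_conv[of u]
    by (simp add: conv_def infsum_cmult_right' flip: mult_scaleR_right)
  finally show ?thesis by (simp add: mult.commute)
qed

lemma fourier_kernel:
  assumes "walk_kernel a"
  shows "fourier a k = complex_of_real (a_hat a k)" and "a_hat a k \<le> 1"
proof -
  interpret prob_kernel a using assms by (rule walk_kernel_prob_kernel)
  have sym: "a (- z) = a z" for z using assms by (simp add: walk_kernel_def)
  have s: "(\<lambda>x. a x *\<^sub>R cis (k \<bullet> lattice_vec x)) abs_summable_on UNIV"
    using summable by (simp add: nonneg)
  note s' = abs_summable_summable[OF s]
  have re: "Re (fourier a k) = a_hat a k"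
    unfolding fourier_def a_hat_def infsum_Re[OF s', symmetric] by simp
  have "cnj (fourier a k) = (\<Sum>\<^sub>\<infinity>x. a (- x) *\<^sub>R cis (k \<bullet> lattice_vec (- x)))"
    unfolding fourier_def infsum_cnj[symmetric] by (simp add: sym lattice_vec_minus cis_cnj)
  also have "\<dots> = fourier a k"
    unfolding fourier_def by (rule infsum_reindex_bij_betw) (rule bij_uminus)
  finally have "fourier a k \<in> \<real>"
    by (simp add: Reals_cnj_iff)
  then show "fourier a k = complex_of_real (a_hat a k)"
    by (simp add: re[symmetric])
  have "a_hat a k \<le> norm (fourier a k)"
    unfolding re[symmetric] by (rule complex_Re_le_cmod)
  also have "\<dots> \<le> (\<Sum>\<^sub>\<infinity>x. norm (a x *\<^sub>R cis (k \<bullet> lattice_vec x)))"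
    unfolding fourier_def by (rule norm_infsum_bound[OF s])
  finally show "a_hat a k \<le> 1"
    by (simp add: nonneg infsum_eq_1)
qed

lemma fourier_green:
  assumes a: "walk_kernel a" and s: "s > 0"
  shows "fourier (green a s) k = complex_of_real (1 / (s + (1 - a_hat a k)))"
proof -
  interpret prob_kernel a using a by (rule walk_kernel_prob_kernel)
  note sum = green_summable[OF s] summable
  have "1 = fourier (indicator {0}) k"
    by (simp add: fourier_eq_conv conv_indicator_left lattice_vec_0)
  also have "indicator {0} = (\<lambda>x. (1 + s) * green a s x - conv a (green a s) x)"
    by (simp add: green_equation[OF s])
  also have "fourier \<dots> k = (1 + s) *\<^sub>R fourier (green a s) k - fourier (conv a (green a s)) k"
    unfolding fourier_eq_conv
    by (subst conv_diff_left[where M = 1])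
      (auto intro!: summable_on_cmult_right conv_summable sum simp: conv_scaleR_left)
  also have "\<dots> = complex_of_real (s + (1 - a_hat a k)) * fourier (green a s) k"
    unfolding fourier_conv[OF sum(2,1)] fourier_kernel(1)[OF a]
    by (simp add: scaleR_conv_of_real algebra_simps)
  finally have eq: "1 = complex_of_real (s + (1 - a_hat a k)) * fourier (green a s) k" .
  have "s + (1 - a_hat a k) > 0"
    using fourier_kernel(2)[OF a, of k] s by simp
  then have "complex_of_real (s + (1 - a_hat a k)) \<noteq> 0"
    unfolding of_real_eq_0_iff by simp
  then show ?thesis
    using eq by (simp add: field_simps)
qed

lemma torus_eq_cbox: "torus = cbox (\<chi> i. - pi) (\<chi> i. pi)"
  by (auto simp: torus_def mem_box_cart)

lemma integral_character_interval:
  fixes n :: int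
  defines "h \<equiv> \<lambda>t. indicator {- pi..pi} t *\<^sub>R cis (t * real_of_int n)"
  shows "has_bochner_integral lborel h (if n = 0 then complex_of_real (2 * pi) else 0)"
proof (cases "n = 0")
  case True
  have "has_bochner_integral lborel (\<lambda>t. indicator {- pi..pi} t *\<^sub>R (1::complex))
      (complex_of_real pi - complex_of_real (- pi))"
    by (rule has_bochner_integral_FTC_Icc) (auto intro!: derivative_eq_intros)
  then show ?thesis using True by (simp add: h_def)
next
  case False
  have d: "((\<lambda>t. cis (t * real_of_int n) / (\<i> * of_int n)) has_vector_derivative cis (t * real_of_int n))
      (at t within A)" for t A
  proof -
    have "((\<lambda>z. exp (\<i> * z * of_int n) / (\<i> * of_int n)) has_field_derivative exp (\<i> * of_real t * of_int n))
        (at (of_real t))"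
      using False by (auto intro!: derivative_eq_intros)
    from has_vector_derivative_real_field[OF this] show ?thesis
      by (simp add: cis_conv_exp mult.assoc)
  qed
  have "has_bochner_integral lborel h
      (cis (pi * real_of_int n) / (\<i> * of_int n) - cis (- pi * real_of_int n) / (\<i> * of_int n))"
    unfolding h_def
    by (rule has_bochner_integral_FTC_Icc) (auto intro!: d continuous_intros)
  moreover have "cis (pi * real_of_int n) = cis (- pi * real_of_int n)"
    by (simp add: complex_eq_iff mult.commute)
  ultimately show ?thesis using False by simp
qed

text \<open>Orthogonality of characters. The integral over the torus factors into one-dimensional ones; the
  function \<open>h b\<close> is the factor belonging to the coordinate \<open>b\<close>.\<close>

lemma has_integral_character:
  fixes x :: "int ^ 'd"
  shows "((\<lambda>k. cis (k \<bullet> lattice_vec x)) has_integral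
    (if x = 0 then complex_of_real ((2 * pi) ^ CARD('d)) else 0)) torus"
proof -
  define h where "h b t = indicator {- pi..pi} t *\<^sub>R cis (t * (lattice_vec x \<bullet> b))" for b :: "real ^ 'd" and t
  define v where "v b = (if lattice_vec x \<bullet> b = 0 then complex_of_real (2 * pi) else 0)" for b :: "real ^ 'd"
  have h: "has_bochner_integral lborel (h b) (v b)" if "b \<in> Basis" for b
  proof -
    obtain i where b: "b = axis i 1"
      using \<open>b \<in> Basis\<close> by (auto simp: Basis_vec_def)
    have "lattice_vec x \<bullet> b = real_of_int (x $ i)"
      by (simp add: b inner_axis lattice_vec_def)
    then show ?thesis
      using integral_character_interval[of "x $ i"] by (simp add: h_def[abs_def] v_def)
  qed
  then have [measurable]: "h b \<in> borel_measurable borel" if "b \<in> Basis" for b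
    using borel_measurable_has_bochner_integral that by fastforce
  have prod: "(\<Prod>b\<in>Basis. h b (k \<bullet> b)) = indicator torus k *\<^sub>R cis (k \<bullet> lattice_vec x)" for k
  proof -
    have "(\<Prod>b\<in>Basis. h b (k \<bullet> b)) =
        (\<Prod>b\<in>Basis. complex_of_real (indicator {- pi..pi} (k \<bullet> b))) *
        (\<Prod>b\<in>Basis. cis ((k \<bullet> b) * (lattice_vec x \<bullet> b)))"
      by (simp add: h_def scaleR_conv_of_real prod.distrib)
    also have "(\<Prod>b\<in>Basis. cis ((k \<bullet> b) * (lattice_vec x \<bullet> b))) = cis (k \<bullet> lattice_vec x)"
      using euclidean_inner[of k "lattice_vec x"] by (simp add: cis_conv_exp sum_distrib_left exp_sum)
    also have "(\<Prod>b\<in>Basis. complex_of_real (indicator {- pi..pi} (k \<bullet> b))) = complex_of_real (indicator torus k)"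
    proof (cases "k \<in> torus")
      case True
      then have "k \<bullet> b \<in> {- pi..pi}" if "b \<in> Basis" for b
        using that by (auto simp: torus_def Basis_vec_def inner_axis)
      then show ?thesis using True by simp
    next
      case False
      then obtain i where "k $ i \<notin> {- pi..pi}" by (auto simp: torus_def)
      then have "\<exists>b\<in>Basis. complex_of_real (indicator {- pi..pi} (k \<bullet> b)) = 0"
        by (intro bexI[of _ "axis i 1"]) (auto simp: inner_axis indicator_def)
      then show ?thesis using False by (simp add: prod_zero)
    qed
    finally show ?thesis by (simp add: scaleR_conv_of_real)
  qed
  interpret product_sigma_finite "\<lambda>_::real ^ 'd. lborel :: real measure" ..
  have "(\<integral>k. (\<Prod>b\<in>Basis. h b (k \<bullet> b)) \<partial>lborel) =
      (\<integral>f. (\<Prod>b\<in>Basis. h b ((\<Sum>b\<in>Basis. f b *\<^sub>R b) \<bullet> b)) \<partial>(\<Pi>\<^sub>M b\<in>(Basis::(real ^ 'd) set). lborel))"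
    by (subst lborel_eq, subst integral_distr) auto
  also have "\<dots> = (\<integral>f. (\<Prod>b\<in>Basis. h b (f b)) \<partial>(\<Pi>\<^sub>M b\<in>(Basis::(real ^ 'd) set). lborel))"
    by (intro Bochner_Integration.integral_cong refl prod.cong) (simp_all add: inner_sum_left_Basis)
  also have "\<dots> = (\<Prod>b\<in>Basis. integral\<^sup>L lborel (h b))"
    by (rule product_integral_prod) (use h in \<open>auto simp: has_bochner_integral_iff\<close>)
  also have "\<dots> = (\<Prod>b\<in>Basis. v b)"
    using h by (intro prod.cong) (auto simp: has_bochner_integral_iff)
  also have "\<dots> = (if x = 0 then complex_of_real ((2 * pi) ^ CARD('d)) else 0)"
  proof (cases "x = 0")
    case True
    then show ?thesis by (simp add: v_def lattice_vec_0)
  next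
    case False
    then obtain i where "x $ i \<noteq> 0" by (auto simp: vec_eq_iff)
    then have "\<exists>b\<in>Basis. v b = 0"
      by (intro bexI[of _ "axis i 1"]) (auto simp: v_def inner_axis lattice_vec_def)
    then show ?thesis using False by (simp add: prod_zero)
  qed
  finally have val: "(LINT k:torus|lborel. cis (k \<bullet> lattice_vec x)) =
      (if x = 0 then complex_of_real ((2 * pi) ^ CARD('d)) else 0)"
    by (simp add: prod set_lebesgue_integral_def)
  have "set_integrable lborel torus (\<lambda>k. cis (k \<bullet> lattice_vec x))"
    unfolding set_integrable_def torus_eq_cbox
    by (intro borel_integrable_compact compact_cbox continuous_intros)
  note * = set_borel_integral_eq_integral[OF this]
  show ?thesis
    using integrable_integral[OF *(1)] unfolding *(2)[symmetric] val .
qed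

lemma fourier_uniform_limit:
  assumes "u summable_on UNIV"
  shows "uniform_limit A (\<lambda>X k. \<Sum>x\<in>X. u x *\<^sub>R cis (k \<bullet> lattice_vec x)) (fourier u) (finite_subsets_at_top UNIV)"
  unfolding fourier_def[abs_def]
  by (rule Weierstrass_m_test_general[where M = "\<lambda>x. \<bar>u x\<bar>"]) (use assms in \<open>auto simp: summable_on_abs_iff\<close>)

lemma fourier_continuous:
  assumes "u summable_on UNIV"
  shows "continuous_on A (fourier u)"
  by (rule uniform_limit_theorem[OF always_eventually fourier_uniform_limit[OF assms]])
    (auto intro!: continuous_intros)

text \<open>A Fourier coefficient is recovered by integration, as the series converges uniformly.\<close>

lemma has_integral_fourier:
  fixes u :: "int ^ 'd \<Rightarrow> real"
  assumes u: "u summable_on UNIV"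
  shows "(fourier u has_integral complex_of_real ((2 * pi) ^ CARD('d) * u 0)) torus"
proof -
  let ?C = "complex_of_real ((2 * pi) ^ CARD('d))"
  obtain I J where IJ: "\<And>X. ((\<lambda>k. \<Sum>x\<in>X. u x *\<^sub>R cis (k \<bullet> lattice_vec x)) has_integral I X) torus"
      "(fourier u has_integral J) torus" "(I \<longlongrightarrow> J) (finite_subsets_at_top UNIV)"
  proof (rule uniform_limit_integral_cbox[OF fourier_uniform_limit[OF u],
        of "\<chi> i. - pi" "\<chi> i. pi", folded torus_eq_cbox])
    show "continuous_on torus (\<lambda>k. \<Sum>x\<in>X. u x *\<^sub>R cis (k \<bullet> lattice_vec x))" for X
      by (intro continuous_intros)
  qed auto
  have I: "I X = u 0 *\<^sub>R ?C" if X: "finite X" "0 \<in> X" for X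
  proof -
    have "((\<lambda>k. \<Sum>x\<in>X. u x *\<^sub>R cis (k \<bullet> lattice_vec x)) has_integral
        (\<Sum>x\<in>X. u x *\<^sub>R (if x = 0 then ?C else 0))) torus"
      by (intro has_integral_sum has_integral_cmul has_integral_character X)
    also have "(\<Sum>x\<in>X. u x *\<^sub>R (if x = 0 then ?C else 0)) = u 0 *\<^sub>R ?C"
      using X by (subst sum.mono_neutral_right[of _ "{0}"]) auto
    finally show ?thesis
      using IJ(1)[of X] has_integral_unique by blast
  qed
  have "eventually (\<lambda>X. finite X \<and> {0} \<subseteq> X) (finite_subsets_at_top (UNIV :: (int ^ 'd) set))"
    by (rule eventually_finite_subsets_at_top_weakI[THEN eventually_conj, OF _ eventually_finite_subsets_at_top[THEN iffD2]]) auto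
  then have "eventually (\<lambda>X. I X = u 0 *\<^sub>R ?C) (finite_subsets_at_top UNIV)"
    by (rule eventually_mono) (rule I; simp)
  then have "(I \<longlongrightarrow> u 0 *\<^sub>R ?C) (finite_subsets_at_top UNIV)"
    by (rule tendsto_eventually)
  then have "J = u 0 *\<^sub>R ?C"
    using IJ(3) tendsto_unique[OF finite_subsets_at_top_neq_bot] by blast
  then show ?thesis
    using IJ(2) by (simp add: scaleR_conv_of_real mult.commute)
qed

lemma torus_integral_green:
  fixes a :: "int ^ 'd \<Rightarrow> real"
  assumes a: "walk_kernel a" and s: "s > 0"
  shows "(\<integral>\<^sup>+k\<in>torus. ennreal (1 / (s + (1 - a_hat a k))) \<partial>lborel) = ennreal ((2 * pi) ^ CARD('d) * green a s 0)"
proof (rule nn_integral_has_integral_lebesgue')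
  interpret prob_kernel a using a by (rule walk_kernel_prob_kernel)
  show "0 \<le> 1 / (s + (1 - a_hat a k))" for k
    using fourier_kernel(2)[OF a, of k] s by simp
  show "((\<lambda>k. 1 / (s + (1 - a_hat a k))) has_integral (2 * pi) ^ CARD('d) * green a s 0) torus"
    using has_integral_linear[OF has_integral_fourier[OF green_summable[OF s]] bounded_linear_Re]
    by (simp add: o_def fourier_green[OF a s])
qed

lemma a_hat_measurable:
  assumes a: "walk_kernel a"
  shows "a_hat a \<in> borel_measurable borel"
proof -
  interpret prob_kernel a using a by (rule walk_kernel_prob_kernel)
  have "a_hat a = (\<lambda>k. Re (fourier a k))"
    by (simp add: fourier_kernel(1)[OF a])
  moreover have "continuous_on UNIV (\<lambda>k. Re (fourier a k))"
    by (intro continuous_intros fourier_continuous summable)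
  ultimately show ?thesis
    by (simp add: borel_measurable_continuous_onI)
qed

text \<open>The case \<open>t = 0\<close>, where the right-hand side is \<open>\<infinity>\<close>, covers the point \<open>k = 0\<close> of the torus.\<close>

lemma SUP_ennreal_shifted_reciprocal:
  assumes "t \<ge> 0"
  shows "incseq (\<lambda>j. ennreal (1 / (inverse (real (Suc j)) + t)))"
    and "(SUP j. ennreal (1 / (inverse (real (Suc j)) + t))) = 1 / ennreal t"
proof -
  show inc: "incseq (\<lambda>j. ennreal (1 / (inverse (real (Suc j)) + t)))"
    using assms by (intro incseq_SucI ennreal_leI divide_left_mono add_right_mono mult_pos_pos add_pos_nonneg)
      (auto simp: field_simps)
  have "(\<lambda>j. ennreal (1 / (inverse (real (Suc j)) + t))) \<longlonglongrightarrow> 1 / ennreal t"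
  proof (cases "t = 0")
    case True
    have "(\<lambda>j. ennreal (real (Suc j))) \<longlonglongrightarrow> top"
      unfolding ennreal_of_nat_eq_real_of_nat[symmetric]
      using of_nat_tendsto_top_ennreal by (rule LIMSEQ_Suc)
    then show ?thesis
      using True by (simp add: divide_inverse del: of_nat_Suc)
  next
    case False
    then have t: "t > 0" using assms by simp
    have "(\<lambda>j. 1 / (inverse (real (Suc j)) + t)) \<longlonglongrightarrow> 1 / (0 + t)"
      using t by (intro tendsto_intros LIMSEQ_inverse_real_of_nat) auto
    then have "(\<lambda>j. ennreal (1 / (inverse (real (Suc j)) + t))) \<longlonglongrightarrow> ennreal (1 / t)"
      by (intro tendsto_ennrealI) simp
    then show ?thesis
      using t by (simp add: divide_ennreal flip: ennreal_1)
  qed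
  with LIMSEQ_SUP[OF inc] show "(SUP j. ennreal (1 / (inverse (real (Suc j)) + t))) = 1 / ennreal t"
    by (rule LIMSEQ_unique)
qed

lemma torus_integral_eq_SUP:
  fixes a :: "int ^ 'd \<Rightarrow> real"
  assumes a: "walk_kernel a"
  shows "torus_integral a = (SUP j. ennreal ((2 * pi) ^ CARD('d) * green a (inverse (real (Suc j))) 0))"
proof -
  note [measurable] = a_hat_measurable[OF a]
  have [measurable]: "torus \<in> sets (borel :: (real ^ 'd) measure)"
    by (simp add: torus_eq_cbox)
  have nn: "0 \<le> 1 - a_hat a k" for k
    using fourier_kernel(2)[OF a, of k] by simp
  have "torus_integral a =
      (\<integral>\<^sup>+k. (SUP j. ennreal (1 / (inverse (real (Suc j)) + (1 - a_hat a k))) * indicator torus k) \<partial>lborel)"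
    unfolding torus_integral_def SUP_ennreal_shifted_reciprocal(2)[OF nn, symmetric]
    by (simp add: SUP_mult_right_ennreal)
  also have "\<dots> = (SUP j. \<integral>\<^sup>+k\<in>torus. ennreal (1 / (inverse (real (Suc j)) + (1 - a_hat a k))) \<partial>lborel)"
  proof (rule nn_integral_monotone_convergence_SUP)
    show "incseq (\<lambda>j k. ennreal (1 / (inverse (real (Suc j)) + (1 - a_hat a k))) * indicator torus k)"
      using SUP_ennreal_shifted_reciprocal(1)[OF nn]
      by (auto simp: incseq_def le_fun_def intro!: mult_right_mono)
  qed measurable
  also have "\<dots> = (SUP j. ennreal ((2 * pi) ^ CARD('d) * green a (inverse (real (Suc j))) 0))"
    by (intro SUP_cong refl torus_integral_green[OF a]) simp
  finally show ?thesis .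
qed

lemma (in prob_kernel) SUP_green_eq_top_iff:
  assumes C: "C > 0"
  shows "(SUP j. ennreal (C * green a (inverse (real (Suc j))) 0)) = \<infinity> \<longleftrightarrow>
    (\<forall>M. \<exists>s>0. green a s 0 > M)"
proof
  assume top: "(SUP j. ennreal (C * green a (inverse (real (Suc j))) 0)) = \<infinity>"
  show "\<forall>M. \<exists>s>0. green a s 0 > M"
  proof
    fix M
    have "ennreal (C * M) < (SUP j. ennreal (C * green a (inverse (real (Suc j))) 0))"
      unfolding top by simp
    then obtain j where "ennreal (C * M) < ennreal (C * green a (inverse (real (Suc j))) 0)"
      by (auto simp: less_SUP_iff)
    then have "C * M < C * green a (inverse (real (Suc j))) 0"
      by (metis ennreal_leI not_le)
    then show "\<exists>s>0. green a s 0 > M"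
      using C by (intro exI[of _ "inverse (real (Suc j))"]) auto
  qed
next
  assume unb: "\<forall>M. \<exists>s>0. green a s 0 > M"
  have "(SUP j. ennreal (C * green a (inverse (real (Suc j))) 0)) = top"
  proof (rule ennreal_SUP_eq_top)
    fix n :: nat
    obtain s where s: "s > 0" "green a s 0 > real n / C" using unb by blast
    obtain j where j: "inverse (real (Suc j)) < s"
      using reals_Archimedean[OF s(1)] by blast
    have "green a s 0 < green a (inverse (real (Suc j))) 0"
      using j by (intro green_0_decreasing) auto
    then have "real n / C \<le> green a (inverse (real (Suc j))) 0"
      using s by simp
    then have "real n \<le> C * green a (inverse (real (Suc j))) 0"
      using C by (simp add: field_simps)
    then show "\<exists>j\<in>UNIV. of_nat n \<le> ennreal (C * green a (inverse (real (Suc j))) 0)"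
      unfolding ennreal_of_nat_eq_real_of_nat using ennreal_leI by blast
  qed
  then show "(SUP j. ennreal (C * green a (inverse (real (Suc j))) 0)) = \<infinity>" by simp
qed

section \<open>The expected time spent at the origin\<close>

text \<open>The semigroup on bounded functions given by a transition function.\<close>

locale transition =
  fixes p :: "real \<Rightarrow> int ^ 'd \<Rightarrow> int ^ 'd \<Rightarrow> real"
  assumes transition: "transition_function p"
begin

lemma p_nonneg: "t \<ge> 0 \<Longrightarrow> p t x y \<ge> 0"
  using transition by (simp add: transition_function_def)

lemma p_has_sum: "t \<ge> 0 \<Longrightarrow> (p t x has_sum 1) UNIV"
  using transition by (simp add: transition_function_def)

lemma p_summable: "t \<ge> 0 \<Longrightarrow> p t x summable_on UNIV"
  using p_has_sum by (rule has_sum_imp_summable)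

lemma semigroup_summable:
  assumes "t \<ge> 0" "\<And>x. \<bar>f x\<bar> \<le> M"
  shows "(\<lambda>y. p t x y * f y) summable_on UNIV"
  using abs_summable_summable[OF abs_summable_scaleR_bounded[OF p_summable[OF assms(1)]], of f M] assms(2)
  by simp

lemma semigroup_bound:
  assumes t: "t \<ge> 0" and f: "\<And>x. \<bar>f x\<bar> \<le> M"
  shows "\<bar>semigroup_of p t f x\<bar> \<le> M"
proof -
  have "(\<lambda>y. p t x y * f y) summable_on UNIV"
    by (rule semigroup_summable[OF assms])
  then have s: "(\<lambda>y. norm (p t x y * f y)) summable_on UNIV"
    by (simp only: real_norm_def summable_on_abs_iff)
  then have "norm (semigroup_of p t f x) \<le> (\<Sum>\<^sub>\<infinity>y. norm (p t x y * f y))"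
    unfolding semigroup_of_def by (rule norm_infsum_bound)
  also have "\<dots> \<le> (\<Sum>\<^sub>\<infinity>y. p t x y * M)"
    using f p_nonneg[OF t]
    by (intro infsum_mono summable_on_cmult_left p_summable[OF t] s)
      (auto simp: abs_mult intro!: mult_left_mono)
  also have "\<dots> = M"
    using infsumI[OF p_has_sum[OF t, of x]] by (simp add: infsum_cmult_left')
  finally show ?thesis by simp
qed

lemma semigroup_add:
  assumes "t \<ge> 0" "\<And>x. \<bar>f x\<bar> \<le> M" "\<And>x. \<bar>g x\<bar> \<le> N"
  shows "semigroup_of p t (\<lambda>x. f x + g x) x = semigroup_of p t f x + semigroup_of p t g x"
  unfolding semigroup_of_def distrib_left
  using assms by (intro infsum_add semigroup_summable)

lemma semigroup_cmult: "semigroup_of p t (\<lambda>x. c * f x) x = c * semigroup_of p t f x"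
  unfolding semigroup_of_def by (simp add: mult.left_commute[of _ c] infsum_cmult_right')

lemma semigroup_compose:
  assumes s: "s \<ge> 0" and t: "t \<ge> 0" and f: "\<And>x. \<bar>f x\<bar> \<le> M"
  shows "semigroup_of p (s + t) f x = semigroup_of p s (semigroup_of p t f) x"
proof -
  have "(\<lambda>(y, z). p s x y * p t y z) abs_summable_on UNIV \<times> UNIV"
  proof (rule Infinite_Sum.abs_summable_on_Sigma_iff[THEN iffD2], intro conjI ballI)
    show "(\<lambda>z. case (y, z) of (y, z) \<Rightarrow> p s x y * p t y z) abs_summable_on UNIV" for y
      using p_summable[OF t] p_nonneg[OF s] p_nonneg[OF t]
      by (simp add: abs_mult summable_on_cmult_right)
    show "(\<lambda>y. \<Sum>\<^sub>\<infinity>z. norm (case (y, z) of (y, z) \<Rightarrow> p s x y * p t y z)) abs_summable_on UNIV"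
      using p_summable[OF s] p_nonneg[OF s] p_nonneg[OF t] infsumI[OF p_has_sum[OF t]]
      by (simp add: abs_mult infsum_cmult_right')
  qed
  from abs_summable_scaleR_bounded[OF abs_summable_summable[OF this], of "\<lambda>(y, z). f z" M]
  have "(\<lambda>q. (case q of (y, z) \<Rightarrow> p s x y * p t y z) *\<^sub>R (case q of (y, z) \<Rightarrow> f z)) abs_summable_on UNIV \<times> UNIV"
    using f by (simp add: case_prod_unfold)
  then have sm: "(\<lambda>(y, z). p s x y * p t y z * f z) summable_on UNIV \<times> UNIV"
    by (rule abs_summable_summable[THEN summable_on_cong[THEN iffD1, rotated]]) auto
  have ck: "((\<lambda>y. p s x y * p t y z) has_sum p (s + t) x z) UNIV" for z
    using transition s t by (simp add: transition_function_def)
  have "semigroup_of p (s + t) f x = (\<Sum>\<^sub>\<infinity>z. \<Sum>\<^sub>\<infinity>y. p s x y * p t y z * f z)"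
    unfolding semigroup_of_def by (simp add: infsum_cmult_left' infsumI[OF ck])
  also have "\<dots> = (\<Sum>\<^sub>\<infinity>y. \<Sum>\<^sub>\<infinity>z. p s x y * p t y z * f z)"
    by (rule infsum_swap_banach[OF sm, symmetric])
  also have "\<dots> = semigroup_of p s (semigroup_of p t f) x"
    unfolding semigroup_of_def by (simp add: mult.assoc infsum_cmult_right')
  finally show ?thesis .
qed

lemma semigroup_indicator: "semigroup_of p t (indicator {y}) x = p t x y"
  unfolding semigroup_of_def by (subst infsum_single[of y]) (auto simp: indicator_def)

text \<open>Differentiability at time \<open>0\<close> is uniform in space, and the semigroup is a contraction; so the
  first-order expansion holds uniformly in the starting time \<open>t\<close> as well.\<close>

lemma generator_increment:
  assumes gen: "has_generator p L"
    and f: "\<And>x. \<bar>f x\<bar> \<le> M" and Lf: "\<And>x. \<bar>L f x\<bar> \<le> N" and e: "e > 0"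
  obtains d where "d > 0"
    and "\<And>h t x. 0 \<le> h \<Longrightarrow> h < d \<Longrightarrow> t \<ge> 0 \<Longrightarrow>
      \<bar>semigroup_of p (t + h) f x - semigroup_of p t f x - h * semigroup_of p t (L f) x\<bar> \<le> e * h"
proof -
  have "bounded (range f)"
    using f by (auto simp: bounded_iff)
  then have "uniform_limit UNIV (\<lambda>h x. (semigroup_of p h f x - f x) / h) (L f) (at_right 0)"
    using gen by (simp add: has_generator_def)
  from uniform_limitD[OF this e] obtain d where d: "d > 0"
    and lim: "\<And>h x. 0 < h \<Longrightarrow> h < d \<Longrightarrow> \<bar>(semigroup_of p h f x - f x) / h - L f x\<bar> < e"
    by (auto simp: eventually_at_right_field dist_real_def)
  have "\<bar>semigroup_of p (t + h) f x - semigroup_of p t f x - h * semigroup_of p t (L f) x\<bar> \<le> e * h"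
    if h: "0 \<le> h" "h < d" and t: "t \<ge> 0" for h t x
  proof (cases "h = 0")
    case False
    then have h0: "h > 0" using h by simp
    let ?r = "\<lambda>x. semigroup_of p h f x + ((-1) * f x + (- h) * L f x)"
    have "\<bar>(-1) * f x + (- h) * L f x\<bar> \<le> M + h * N" for x
    proof -
      have "\<bar>(-1) * f x + (- h) * L f x\<bar> \<le> \<bar>f x\<bar> + h * \<bar>L f x\<bar>"
        using abs_triangle_ineq[of "(-1) * f x" "(- h) * L f x"] h by (simp add: abs_mult)
      also have "\<dots> \<le> M + h * N"
        using f Lf h by (intro add_mono mult_left_mono) auto
      finally show ?thesis .
    qed
    then have "semigroup_of p t ?r x = semigroup_of p t (semigroup_of p h f) x +
        semigroup_of p t (\<lambda>x. (-1) * f x + (- h) * L f x) x"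
      by (intro semigroup_add[OF t semigroup_bound[OF h(1) f]])
    also have "semigroup_of p t (\<lambda>x. (-1) * f x + (- h) * L f x) x =
        semigroup_of p t (\<lambda>x. (-1) * f x) x + semigroup_of p t (\<lambda>x. (- h) * L f x) x"
      by (rule semigroup_add[OF t, of _ M _ "h * N"]) (use f Lf h in \<open>auto simp: abs_mult mult_left_mono\<close>)
    finally have eq: "semigroup_of p (t + h) f x - semigroup_of p t f x - h * semigroup_of p t (L f) x =
        semigroup_of p t ?r x"
      unfolding semigroup_cmult semigroup_compose[OF t h(1) f] by simp
    have "\<bar>?r x\<bar> \<le> e * h" for x
    proof -
      have "?r x = h * ((semigroup_of p h f x - f x) / h - L f x)"
        using h0 by (simp add: field_simps)
      then have "\<bar>?r x\<bar> = h * \<bar>(semigroup_of p h f x - f x) / h - L f x\<bar>"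
        using h0 by (simp add: abs_mult)
      also have "\<dots> \<le> h * e"
        using lim[OF h0 h(2), of x] h0 by (intro mult_left_mono) auto
      finally show ?thesis by (simp add: mult.commute)
    qed
    from semigroup_bound[OF t this] show ?thesis
      unfolding eq .
  qed simp
  with d show ?thesis by (rule that)
qed

text \<open>Kolmogorov's equation. For the left derivative, the expansion is taken at the earlier time \<open>y\<close>,
  and \<open>T\<^sub>y L f\<close> is compared with \<open>T\<^sub>t L f\<close>; for this, \<open>L L f\<close> has to be bounded, too.\<close>

lemma semigroup_has_derivative:
  assumes gen: "has_generator p L"
    and f: "\<And>x. \<bar>f x\<bar> \<le> M" and Lf: "\<And>x. \<bar>L f x\<bar> \<le> N" and LLf: "\<And>x. \<bar>L (L f) x\<bar> \<le> K"
    and t: "t \<ge> 0"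
  shows "((\<lambda>t. semigroup_of p t f x) has_real_derivative semigroup_of p t (L f) x) (at t within {0..})"
proof -
  let ?T = "semigroup_of p"
  have "\<exists>d>0. \<forall>y\<in>{0..}. norm (y - t) < d \<longrightarrow>
      norm (?T y f x - ?T t f x - ?T t (L f) x * (y - t)) \<le> e * norm (y - t)" if e: "e > 0" for e
  proof -
    have K: "K \<ge> 0" using LLf[of 0] abs_ge_zero order_trans by blast
    obtain d1 where d1: "d1 > 0"
      and inc1: "\<And>h t x. 0 \<le> h \<Longrightarrow> h < d1 \<Longrightarrow> t \<ge> 0 \<Longrightarrow>
        \<bar>?T (t + h) f x - ?T t f x - h * ?T t (L f) x\<bar> \<le> e / 2 * h"
      using generator_increment[OF gen f Lf, of "e / 2"] e by auto
    obtain d2 where d2: "d2 > 0"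
      and inc2: "\<And>h t x. 0 \<le> h \<Longrightarrow> h < d2 \<Longrightarrow> t \<ge> 0 \<Longrightarrow>
        \<bar>?T (t + h) (L f) x - ?T t (L f) x - h * ?T t (L (L f)) x\<bar> \<le> 1 * h"
      using generator_increment[OF gen Lf LLf, of 1] by auto
    define d where "d = Min {d1, d2, e / (2 * (K + 1))}"
    have d: "d > 0" "d \<le> d1" "d \<le> d2" "d \<le> e / (2 * (K + 1))"
      using d1 d2 e K by (auto simp: d_def)
    have "norm (?T y f x - ?T t f x - ?T t (L f) x * (y - t)) \<le> e * norm (y - t)"
      if y: "y \<ge> 0" "norm (y - t) < d" for y
    proof (cases "y \<ge> t")
      case True
      have "\<bar>?T (t + (y - t)) f x - ?T t f x - (y - t) * ?T t (L f) x\<bar> \<le> e / 2 * (y - t)"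
        using True y d t by (intro inc1) auto
      also have "\<dots> \<le> e * (y - t)"
        using True e by (intro mult_right_mono) auto
      finally show ?thesis using True by (simp add: mult.commute)
    next
      case False
      define h where "h = t - y"
      have h: "h > 0" "h < d" using False y by (auto simp: h_def)
      have t_eq: "y + h = t" by (simp add: h_def)
      have 1: "\<bar>?T t f x - ?T y f x - h * ?T y (L f) x\<bar> \<le> e / 2 * h"
        using inc1[of h y x] h d y by (simp add: t_eq)
      have "\<bar>?T t (L f) x - ?T y (L f) x\<bar> \<le> h + \<bar>h * ?T y (L (L f)) x\<bar>"
        using inc2[of h y x] h d y by (simp add: t_eq)
      also have "\<dots> \<le> h + h * K"
        using semigroup_bound[OF y(1), of "L (L f)", OF LLf, of x] h by (simp add: abs_mult)
      also have "\<dots> = h * (K + 1)"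
        by (simp add: algebra_simps)
      also have "\<dots> \<le> e / (2 * (K + 1)) * (K + 1)"
        using h d(4) K by (intro mult_right_mono) auto
      also have "\<dots> = e / 2"
        using K by (simp add: field_simps)
      finally have 2: "h * \<bar>?T t (L f) x - ?T y (L f) x\<bar> \<le> h * (e / 2)"
        using h by (intro mult_left_mono) auto
      have eq: "?T y f x - ?T t f x - ?T t (L f) x * (y - t) =
          - (?T t f x - ?T y f x - h * ?T y (L f) x) + h * (?T t (L f) x - ?T y (L f) x)"
        by (simp add: h_def algebra_simps)
      have "\<bar>- (?T t f x - ?T y f x - h * ?T y (L f) x) + h * (?T t (L f) x - ?T y (L f) x)\<bar> \<le>
          \<bar>?T t f x - ?T y f x - h * ?T y (L f) x\<bar> + h * \<bar>?T t (L f) x - ?T y (L f) x\<bar>"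
        using h abs_triangle_ineq[of "- (?T t f x - ?T y f x - h * ?T y (L f) x)" "h * (?T t (L f) x - ?T y (L f) x)"]
        by (simp only: abs_minus abs_mult abs_of_pos)
      also have "\<dots> \<le> e / 2 * h + h * (e / 2)"
        using 1 2 by (rule add_mono)
      finally have "\<bar>?T y f x - ?T t f x - ?T t (L f) x * (y - t)\<bar> \<le> e * h"
        unfolding eq by (simp add: mult.commute)
      then show ?thesis using False by (simp add: h_def)
    qed
    then show ?thesis
      using d(1) by auto
  qed
  then show ?thesis
    unfolding has_field_derivative_def has_derivative_within_alt
    by (auto intro: bounded_linear_mult_right)
qed

end

lemma nn_integral_exp_FTC:
  fixes w f :: "real \<Rightarrow> real"
  assumes w: "\<And>t. t \<ge> 0 \<Longrightarrow> (w has_real_derivative - (exp (- l * t) * f t)) (at t within {0..})"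
    and f: "continuous_on {0..} f" "\<And>t. t \<ge> 0 \<Longrightarrow> f t \<ge> 0"
    and lim: "(w \<longlongrightarrow> 0) at_top"
  shows "(\<integral>\<^sup>+t\<in>{0..}. ennreal (exp (- l * t) * f t) \<partial>lborel) = ennreal (w 0)"
proof -
  let ?g = "\<lambda>t. exp (- l * t) * f t"
  have int: "(\<integral>\<^sup>+t. ennreal (?g t) * indicator {0..real n} t \<partial>lborel) = ennreal (w 0 - w (real n))" for n
  proof (rule nn_integral_has_integral_lebesgue')
    have "((\<lambda>t. - w t) has_vector_derivative ?g t) (at t within {0..real n})" if "t \<in> {0..real n}" for t
      using w[of t] that
      by (intro derivative_eq_intros has_vector_derivative_within_subset[OF
            has_real_derivative_iff_has_vector_derivative[THEN iffD1], of w _ _ "{0..}"]) auto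
    from fundamental_theorem_of_calculus[OF _ this]
    show "(?g has_integral w 0 - w (real n)) {0..real n}" by simp
  qed (use f in auto)
  have inc: "incseq (\<lambda>n t. ennreal (?g t) * indicator {0..real n} t)"
    by (auto simp: incseq_def le_fun_def intro!: mult_left_mono split: split_indicator)
  have meas: "(\<lambda>t. ennreal (?g t) * indicator {0..real n} t) \<in> borel_measurable lborel" for n
  proof -
    have "(\<lambda>t. indicator {0..real n} t *\<^sub>R ?g t) \<in> borel_measurable borel"
      by (intro borel_measurable_continuous_on_indicator continuous_intros continuous_on_subset[OF f(1)]) auto
    then have "(\<lambda>t. ennreal (indicator {0..real n} t *\<^sub>R ?g t)) \<in> borel_measurable lborel"
      by simp
    also have "(\<lambda>t. ennreal (indicator {0..real n} t *\<^sub>R ?g t)) = (\<lambda>t. ennreal (?g t) * indicator {0..real n} t)"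
      by (auto split: split_indicator)
    finally show ?thesis .
  qed
  have "(SUP n. ennreal (?g t) * indicator {0..real n} t) = ennreal (?g t) * indicator {0..} t" for t
  proof (rule antisym)
    show "(SUP n. ennreal (?g t) * indicator {0..real n} t) \<le> ennreal (?g t) * indicator {0..} t"
      by (rule SUP_least) (auto split: split_indicator)
    obtain n where "t \<le> real n" using real_arch_simple by blast
    then show "ennreal (?g t) * indicator {0..} t \<le> (SUP n. ennreal (?g t) * indicator {0..real n} t)"
      by (intro SUP_upper2[of n]) (auto split: split_indicator)
  qed
  then have "(\<integral>\<^sup>+t\<in>{0..}. ennreal (?g t) \<partial>lborel) =
      (\<integral>\<^sup>+t. (SUP n. ennreal (?g t) * indicator {0..real n} t) \<partial>lborel)"
    by simp
  also have "\<dots> = (SUP n. \<integral>\<^sup>+t. ennreal (?g t) * indicator {0..real n} t \<partial>lborel)"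
    by (rule nn_integral_monotone_convergence_SUP[OF inc meas])
  finally have eq: "(\<integral>\<^sup>+t\<in>{0..}. ennreal (?g t) \<partial>lborel) = (SUP n. ennreal (w 0 - w (real n)))"
    unfolding int .
  have "incseq (\<lambda>n. ennreal (w 0 - w (real n)))"
    unfolding int[symmetric] using inc
    by (auto simp: incseq_def le_fun_def intro!: nn_integral_mono)
  from LIMSEQ_SUP[OF this] have "(\<lambda>n. ennreal (w 0 - w (real n))) \<longlonglongrightarrow> (\<integral>\<^sup>+t\<in>{0..}. ennreal (?g t) \<partial>lborel)"
    unfolding eq .
  moreover have "(\<lambda>n. ennreal (w 0 - w (real n))) \<longlonglongrightarrow> ennreal (w 0 - 0)"
    by (intro tendsto_ennrealI tendsto_diff tendsto_const filterlim_compose[OF lim filterlim_real_sequentially])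
  ultimately show ?thesis
    using LIMSEQ_unique by fastforce
qed

text \<open>The function \<open>g = g\<^sub>s/c\<close> is bounded and solves \<open>(cs - cA) g = \<delta>\<^sub>0\<close>.\<close>

lemma laplace_transform_return_probability:
  fixes a :: "int ^ 'd \<Rightarrow> real"
  assumes a: "walk_kernel a" and c: "c > 0" and s: "s > 0"
    and p: "transition_function p" and gen: "has_generator p (\<lambda>f x. c * op_A a f x)"
  shows "continuous_on {0..} (\<lambda>t. p t 0 0)"
    and "(\<integral>\<^sup>+t\<in>{0..}. ennreal (exp (- (c * s) * t) * p t 0 0) \<partial>lborel) = ennreal (1 / c * green a s 0)"
proof -
  interpret prob_kernel a using a by (rule walk_kernel_prob_kernel)
  interpret transition p by unfold_locales (rule p)
  let ?L = "\<lambda>f x. c * op_A a f x"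
  let ?T = "semigroup_of p"
  have L: "op_A a f x = conv a f x - f x" if "\<And>x. \<bar>f x\<bar> \<le> M" for f :: "int ^ 'd \<Rightarrow> real" and M x
    using op_A_eq_conv[OF a, of f M] that by simp
  have bd: "\<bar>?L f x\<bar> \<le> c * (2 * M)" if f: "\<And>x. \<bar>f x\<bar> \<le> M" for f M x
  proof -
    have "\<bar>conv a f x\<bar> \<le> M"
      using norm_conv_le[OF summable nonneg, of f M x] f infsum_eq_1 by simp
    then have "\<bar>conv a f x - f x\<bar> \<le> 2 * M"
      using f[of x] by linarith
    then show ?thesis
      unfolding L[OF f] using c by (simp add: abs_mult)
  qed
  have deriv: "((\<lambda>t. ?T t f x) has_real_derivative ?T t (?L f) x) (at t within {0..})"
    if f: "\<And>x. \<bar>f x\<bar> \<le> M" and t: "t \<ge> 0" for f M t x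
    by (rule semigroup_has_derivative[OF gen f bd[OF f] bd[OF bd[OF f]] t])
  have "continuous_on {0..} (\<lambda>t. ?T t (indicator {0}) 0)"
    by (rule DERIV_continuous_on[OF deriv[of _ 1]]) (auto simp: indicator_def)
  then show cont: "continuous_on {0..} (\<lambda>t. p t 0 0)"
    by (simp add: semigroup_indicator)
  define g where "g x = 1 / c * green a s x" for x
  have g: "\<bar>g x\<bar> \<le> 1 / c * (1 / s)" for x
    unfolding g_def abs_mult using c norm_green_le[OF s, of x] by (intro mult_mono) auto
  have res: "c * s * g x + (-1) * ?L g x = indicator {0} x" for x
  proof -
    have "conv a g x = 1 / c * conv a (green a s) x"
      unfolding g_def[abs_def] using conv_scaleR_right[of a "1 / c" "green a s" x] by simp
    then show ?thesis
      unfolding L[OF g] green_equation[OF s, symmetric] using c by (simp add: g_def[of x] field_simps)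
  qed
  have w': "((\<lambda>t. exp (- (c * s) * t) * ?T t g 0) has_real_derivative - (exp (- (c * s) * t) * p t 0 0))
      (at t within {0..})" if t: "t \<ge> 0" for t
  proof -
    have "p t 0 0 = ?T t (\<lambda>x. c * s * g x + (-1) * ?L g x) 0"
      unfolding res by (simp add: semigroup_indicator)
    also have "\<dots> = ?T t (\<lambda>x. c * s * g x) 0 + ?T t (\<lambda>x. (-1) * ?L g x) 0"
    proof (rule semigroup_add[OF t])
      show "\<bar>c * s * g x\<bar> \<le> c * s * (1 / c * (1 / s))" for x
        using mult_left_mono[OF g[of x], of "c * s"] c s by (simp add: abs_mult)
      show "\<bar>(-1) * ?L g x\<bar> \<le> c * (2 * (1 / c * (1 / s)))" for x
        using bd[of g, OF g, of x] by simp
    qed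
    finally have p_eq: "p t 0 0 = c * s * ?T t g 0 - ?T t (?L g) 0"
      unfolding semigroup_cmult by simp
    show ?thesis
      unfolding p_eq by (rule derivative_eq_intros deriv[OF g t] refl | simp add: algebra_simps)+
  qed
  have lim: "((\<lambda>t. exp (- (c * s) * t) * ?T t g 0) \<longlongrightarrow> 0) at_top"
  proof (rule Lim_null_comparison)
    show "eventually (\<lambda>t. norm (exp (- (c * s) * t) * ?T t g 0) \<le> exp (- (c * s) * t) * (1 / c * (1 / s))) at_top"
      using eventually_ge_at_top[of 0]
    proof eventually_elim
      case (elim t)
      from semigroup_bound[of t g, OF elim g, of 0] show ?case
        unfolding norm_mult by (intro mult_mono) auto
    qed
    have "((\<lambda>t. exp (- (c * s) * t)) \<longlongrightarrow> 0) at_top"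
      using c s by real_asymp
    then show "((\<lambda>t. exp (- (c * s) * t) * (1 / c * (1 / s))) \<longlongrightarrow> 0) at_top"
      by (rule tendsto_mult_left_zero)
  qed
  have "?T 0 g 0 = g 0"
    using p unfolding semigroup_of_def transition_function_def by (subst infsum_single[of 0]) auto
  then show "(\<integral>\<^sup>+t\<in>{0..}. ennreal (exp (- (c * s) * t) * p t 0 0) \<partial>lborel) = ennreal (1 / c * green a s 0)"
    using nn_integral_exp_FTC[OF w' cont p_nonneg lim] by (simp add: g_def)
qed

lemma green0_eq_SUP:
  fixes a :: "int ^ 'd \<Rightarrow> real"
  assumes a: "walk_kernel a" and c: "c > 0"
    and p: "transition_function p" and gen: "has_generator p (\<lambda>f x. c * op_A a f x)"
  shows "green0 p 0 0 = (SUP j. ennreal (1 / c * green a (inverse (real (Suc j))) 0))"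
proof -
  let ?f = "\<lambda>j t. ennreal (exp (- (c * inverse (real (Suc j))) * t) * p t 0 0) * indicator {0..} t"
  interpret transition p by unfold_locales (rule p)
  have cont: "continuous_on {0..} (\<lambda>t. p t 0 0)"
    by (rule laplace_transform_return_probability(1)[OF a c zero_less_one p gen])
  have mono: "?f i t \<le> ?f j t" if "i \<le> j" for i j t
  proof (cases "t \<ge> 0")
    case True
    have "inverse (real (Suc j)) \<le> inverse (real (Suc i))"
      using that by (intro le_imp_inverse_le) auto
    then have "exp (- (c * inverse (real (Suc i))) * t) \<le> exp (- (c * inverse (real (Suc j))) * t)"
      using c True by (auto intro!: mult_right_mono mult_left_mono simp del: of_nat_Suc)
    then show ?thesis
      using True p_nonneg[OF True] by (intro mult_right_mono ennreal_leI) auto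
  qed simp
  have inc: "incseq ?f"
    using mono by (simp add: incseq_def le_fun_def)
  have meas: "?f j \<in> borel_measurable lborel" for j
  proof -
    have "(\<lambda>t. indicator {0..} t *\<^sub>R (exp (- (c * inverse (real (Suc j))) * t) * p t 0 0)) \<in> borel_measurable borel"
      by (intro borel_measurable_continuous_on_indicator continuous_intros cont) auto
    then have "(\<lambda>t. ennreal (indicator {0..} t *\<^sub>R (exp (- (c * inverse (real (Suc j))) * t) * p t 0 0)))
        \<in> borel_measurable lborel"
      by simp
    also have "(\<lambda>t. ennreal (indicator {0..} t *\<^sub>R (exp (- (c * inverse (real (Suc j))) * t) * p t 0 0))) = ?f j"
      by (auto split: split_indicator)
    finally show ?thesis .
  qed
  have "(SUP j. ?f j t) = ennreal (p t 0 0) * indicator {0..} t" for t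
  proof (rule LIMSEQ_unique[OF LIMSEQ_SUP])
    show "incseq (\<lambda>j. ?f j t)"
      using mono by (simp add: incseq_def)
    have "(\<lambda>j. exp (- (c * inverse (real (Suc j))) * t) * p t 0 0) \<longlonglongrightarrow> exp (- (c * 0) * t) * p t 0 0"
      by (intro tendsto_intros LIMSEQ_inverse_real_of_nat)
    then have "(\<lambda>j. ennreal (exp (- (c * inverse (real (Suc j))) * t) * p t 0 0)) \<longlonglongrightarrow> ennreal (p t 0 0)"
      by (intro tendsto_ennrealI) simp
    then show "(\<lambda>j. ?f j t) \<longlonglongrightarrow> ennreal (p t 0 0) * indicator {0..} t"
      by (cases "t \<ge> 0") simp_all
  qed
  then have "green0 p 0 0 = (\<integral>\<^sup>+t. (SUP j. ?f j t) \<partial>lborel)"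
    by (simp add: green0_def)
  also have "\<dots> = (SUP j. integral\<^sup>N lborel (?f j))"
    by (rule nn_integral_monotone_convergence_SUP[OF inc meas])
  also have "\<dots> = (SUP j. ennreal (1 / c * green a (inverse (real (Suc j))) 0))"
    by (intro SUP_cong refl laplace_transform_return_probability(2)[OF a c _ p gen]) simp
  finally show ?thesis .
qed

section \<open>The equivalence\<close>

theorem theorem9p1:
  fixes a :: "int ^ 'd \<Rightarrow> real"
  assumes "walk_kernel a"
  shows "((\<forall>\<kappa>>0. lambda0 (H2 \<kappa> a) > 0) \<longleftrightarrow> torus_integral a = \<infinity>) \<and>
         (\<forall>\<kappa>>0. \<forall>p. transition_function p \<and> has_generator p (\<lambda>f x. 2 * \<kappa> * op_A a f x) \<longrightarrow>
            (torus_integral a = \<infinity> \<longleftrightarrow> recurrent p))"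
proof -
  interpret prob_kernel a using assms by (rule walk_kernel_prob_kernel)
  have torus: "torus_integral a = \<infinity> \<longleftrightarrow> (\<forall>M. \<exists>s>0. green a s 0 > M)"
    unfolding torus_integral_eq_SUP[OF assms] by (rule SUP_green_eq_top_iff) simp
  have "recurrent p \<longleftrightarrow> (\<forall>M. \<exists>s>0. green a s 0 > M)"
    if "\<kappa> > 0" "transition_function p" "has_generator p (\<lambda>f x. 2 * \<kappa> * op_A a f x)" for \<kappa> p
  proof -
    have c: "2 * \<kappa> > 0" using that by simp
    show ?thesis
      unfolding recurrent_def green0_eq_SUP[OF assms c that(2,3)]
      by (rule SUP_green_eq_top_iff) (use that in simp)
  qed
  then show ?thesis
    using torus lambda0_pos_iff_green_unbounded[OF assms] by blast
qed

end
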